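(* Let $P$ be an $r$-differential poset and $Q$ an $s$-differential poset, with rank sizes $p_n$ and $q_n$ respectively. Suppose that $\Delta q_n\ge\Delta q_{n-1}$ for all $n\ge2$, and that all the down maps of at least one of $P$, $Q$ are surjective (over $\mathbb{Z}$). Then for the Cartesian product poset $P\times Q$ and every $n\ge0$, the matrix $[DU_n]+xI$ (where $DU_n$ is computed in $P\times Q$ and $I$ is the identity of size equal to the $n$-th rank size of $P\times Q$) has Smith normal form over $\mathbb{Z}[x]$.
   Context: For a positive integer $r$, a poset $P$ is $r$-differential if: (D1) $P$ is graded, locally finite, has all rank sizes finite and a unique minimum element; (D2) if two distinct elements of $P$ both cover exactly $k$ common elements, then exactly $k$ elements cover them both; (D3) if an element covers $k$ elements then it is covered by exactly $k+r$ elements. $P_n$ is the $n$-th rank (empty for $n<0$), $p_n=|P_n|$, $\Delta p_n=p_n-p_{n-1}$. $\mathbb{Z}P_n$ is the free $\mathbb{Z}$-module with basis $P_n$; $U_n:\mathbb{Z}P_n\to\mathbb{Z}P_{n+1}$ sends an element to the sum of all elements covering it, $D_n:\mathbb{Z}P_n\to\mathbb{Z}P_{n-1}$ sends an element to the sum of all elements it covers, $DU_n=D_{n+1}U_n$, and $[DU_n]$ is its matrix in the standard basis. $P\times Q$ is the product poset with componentwise order (it is $(r+s)$-differential). A matrix over a commutative ring $R$ has Smith normal form over $R$ if it can be multiplied on both sides by invertible matrices over $R$ to obtain a diagonal matrix whose diagonal entries satisfy $s_1\mid s_2\mid\cdots$. *)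

theory Defs
  imports "Jordan_Normal_Form.Matrix" "HOL-Computational_Algebra.Polynomial"
begin

definition partial_order_on' :: "'a set \<Rightarrow> ('a \<Rightarrow> 'a \<Rightarrow> bool) \<Rightarrow> bool" where
  "partial_order_on' S leq \<longleftrightarrow>
     (\<forall>x\<in>S. leq x x) \<and>
     (\<forall>x\<in>S. \<forall>y\<in>S. leq x y \<and> leq y x \<longrightarrow> x = y) \<and>
     (\<forall>x\<in>S. \<forall>y\<in>S. \<forall>z\<in>S. leq x y \<and> leq y z \<longrightarrow> leq x z)"

definition covby :: "'a set \<Rightarrow> ('a \<Rightarrow> 'a \<Rightarrow> bool) \<Rightarrow> 'a \<Rightarrow> 'a \<Rightarrow> bool" where
  "covby S leq x y \<longleftrightarrow> x \<in> S \<and> y \<in> S \<and> leq x y \<and> x \<noteq> y \<and>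
     (\<forall>z\<in>S. leq x z \<and> leq z y \<longrightarrow> z = x \<or> z = y)"

definition locally_finite :: "'a set \<Rightarrow> ('a \<Rightarrow> 'a \<Rightarrow> bool) \<Rightarrow> bool" where
  "locally_finite S leq \<longleftrightarrow> (\<forall>x\<in>S. \<forall>y\<in>S. finite {z\<in>S. leq x z \<and> leq z y})"

definition has_unique_min :: "'a set \<Rightarrow> ('a \<Rightarrow> 'a \<Rightarrow> bool) \<Rightarrow> bool" where
  "has_unique_min S leq \<longleftrightarrow> (\<exists>m\<in>S. \<forall>x\<in>S. leq m x)"

definition is_rank_fun :: "'a set \<Rightarrow> ('a \<Rightarrow> 'a \<Rightarrow> bool) \<Rightarrow> ('a \<Rightarrow> nat) \<Rightarrow> bool" where
  "is_rank_fun S leq rk \<longleftrightarrow>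
     (\<forall>x\<in>S. (\<forall>y\<in>S. leq y x \<longrightarrow> y = x) \<longrightarrow> rk x = 0) \<and>
     (\<forall>x y. covby S leq x y \<longrightarrow> rk y = rk x + 1)"

definition graded :: "'a set \<Rightarrow> ('a \<Rightarrow> 'a \<Rightarrow> bool) \<Rightarrow> bool" where
  "graded S leq \<longleftrightarrow> (\<exists>rk. is_rank_fun S leq rk)"

definition rank_of :: "'a set \<Rightarrow> ('a \<Rightarrow> 'a \<Rightarrow> bool) \<Rightarrow> 'a \<Rightarrow> nat" where
  "rank_of S leq = (SOME rk. is_rank_fun S leq rk)"

definition rank_set :: "'a set \<Rightarrow> ('a \<Rightarrow> 'a \<Rightarrow> bool) \<Rightarrow> nat \<Rightarrow> 'a set" where
  "rank_set S leq n = {x\<in>S. rank_of S leq x = n}"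

definition rank_size :: "'a set \<Rightarrow> ('a \<Rightarrow> 'a \<Rightarrow> bool) \<Rightarrow> nat \<Rightarrow> nat" where
  "rank_size S leq n = card (rank_set S leq n)"

definition differential :: "'a set \<Rightarrow> ('a \<Rightarrow> 'a \<Rightarrow> bool) \<Rightarrow> nat \<Rightarrow> bool" where
  "differential S leq r \<longleftrightarrow>
     r > 0 \<and>
     partial_order_on' S leq \<and>
     \<comment> \<open>(D1)\<close>
     graded S leq \<and> locally_finite S leq \<and> (\<forall>n. finite (rank_set S leq n)) \<and> has_unique_min S leq \<and>
     \<comment> \<open>(D2)\<close>
     (\<forall>x\<in>S. \<forall>y\<in>S. x \<noteq> y \<longrightarrow>
        card {z\<in>S. covby S leq z x \<and> covby S leq z y} = card {z\<in>S. covby S leq x z \<and> covby S leq y z}) \<and>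
     \<comment> \<open>(D3)\<close>
     (\<forall>x\<in>S. card {z\<in>S. covby S leq x z} = card {z\<in>S. covby S leq z x} + r)"

definition prod_le :: "('a \<Rightarrow> 'a \<Rightarrow> bool) \<Rightarrow> ('b \<Rightarrow> 'b \<Rightarrow> bool) \<Rightarrow> ('a \<times> 'b) \<Rightarrow> ('a \<times> 'b) \<Rightarrow> bool" where
  "prod_le le1 le2 p q \<longleftrightarrow> le1 (fst p) (fst q) \<and> le2 (snd p) (snd q)"

text \<open>All down maps D_n : Z P_n \<rightarrow> Z P_{n-1} are surjective (n \<ge> 1; for n = 0 the target is 0).
  Elements of Z P_n are represented by their coefficient functions on P_n.\<close>
definition down_maps_surjective :: "'a set \<Rightarrow> ('a \<Rightarrow> 'a \<Rightarrow> bool) \<Rightarrow> bool" where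
  "down_maps_surjective S leq \<longleftrightarrow>
     (\<forall>n\<ge>1. \<forall>g :: 'a \<Rightarrow> int. \<exists>f :: 'a \<Rightarrow> int.
        \<forall>y\<in>rank_set S leq (n - 1).
          (\<Sum>x\<in>rank_set S leq n. if covby S leq y x then f x else 0) = g y)"

text \<open>The matrix [DU_n] + x I over Z[x], w.r.t. the basis of P_n enumerated by the list es.
  Entry (i,j) is the coefficient of es!i in DU(es!j), i.e. the number of z covering both.\<close>
definition DU_plus_xI :: "'a set \<Rightarrow> ('a \<Rightarrow> 'a \<Rightarrow> bool) \<Rightarrow> 'a list \<Rightarrow> int poly mat" where
  "DU_plus_xI S leq es = mat (length es) (length es)
     (\<lambda>(i, j). of_nat (card {z\<in>S. covby S leq (es ! j) z \<and> covby S leq (es ! i) z})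
               + (if i = j then [:0, 1:] else 0))"

definition has_smith_normal_form :: "'a :: comm_ring_1 mat \<Rightarrow> bool" where
  "has_smith_normal_form A \<longleftrightarrow>
     (\<exists>P Q. P \<in> carrier_mat (dim_row A) (dim_row A) \<and> Q \<in> carrier_mat (dim_col A) (dim_col A) \<and>
        invertible_mat P \<and> invertible_mat Q \<and>
        diagonal_mat (P * A * Q) \<and>
        (\<forall>i. Suc i < min (dim_row A) (dim_col A) \<longrightarrow>
            (P * A * Q) $$ (i, i) dvd (P * A * Q) $$ (Suc i, Suc i)))"

end

theory Submission
  imports Defs "Jordan_Normal_Form.Determinant"
begin

text \<open>
  The product is an \<open>R\<close>-differential poset with \<open>R = r + s\<close>, its down maps are surjective, and the
  first differences \<open>d n\<close> of its rank sizes are strictly increasing, except that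
  \<open>d 0 = d 1 = 1\<close> when \<open>r = s = 1\<close>. From \<open>DU - UD = R\<close> we get
  \<open>DU U\<^sup>k c = (k + 1) R U\<^sup>k c + U\<^bsup>k+1\<^esup> D c\<close>. So it suffices to find elements \<open>b i j\<close> of rank \<open>i\<close>, for \<open>j < d i\<close>,
  such that the \<open>U\<^bsup>n-i\<^esup> (b i j)\<close> form a basis of rank \<open>n\<close> and \<open>D (b i j)\<close> is \<open>b (i - 1) j\<close>, or \<open>0\<close> if
  \<open>j \<ge> d (i - 1)\<close>: then \<open>DU + x\<close> splits into Jordan-like chains, each of which is equivalent
  to \<open>diag(1, \<dots>, 1, \<Prod>(x + k R))\<close>, and longer chains have more factors.

  The \<open>b i j\<close> are built rank by rank. As \<open>D\<close> is surjective, the image of its transpose \<open>U\<close> has a complement.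
  Elements of the form \<open>U u\<close> can be added to the basis of the complement so that \<open>D\<close> maps it into
  the span of the previous \<open>b (i - 1) j\<close>. The coordinates of this map can still be altered by multiples of certain
  moduli, each dividing the one before, and modulo these the map is onto. Since \<open>d (i - 1) < d i\<close>, unimodular
  column operations then bring it to the form \<open>(I | 0)\<close> modulo the moduli; in the exceptional case the only
  modulus is \<open>2\<close>, modulo which every unit is \<open>1\<close>.
\<close>

section \<open>Spanning families over commutative rings\<close>

text \<open>Vectors are plain functions, so one notion serves elements of a rank over the integers,
  over polynomials, and bare coefficient vectors.\<close>

definition lspan :: "'i set \<Rightarrow> ('i \<Rightarrow> 'x \<Rightarrow> 'r :: comm_ring_1) \<Rightarrow> ('x \<Rightarrow> 'r) set" where
  "lspan I c = {v. \<exists>a. v = (\<lambda>x. \<Sum>i\<in>I. a i * c i x)}"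

lemma lspanI: "(\<And>x. v x = (\<Sum>i\<in>I. a i * c i x)) \<Longrightarrow> v \<in> lspan I c"
  unfolding lspan_def by auto

lemma lspanE:
  assumes "v \<in> lspan I c"
  obtains a where "v = (\<lambda>x. \<Sum>i\<in>I. a i * c i x)"
  using assms unfolding lspan_def by auto

lemma lspan_cong:
  assumes "\<And>i. i \<in> I \<Longrightarrow> c i = c' i"
  shows "lspan I c = lspan I c'"
proof -
  have "(\<lambda>x. \<Sum>i\<in>I. a i * c i x) = (\<lambda>x. \<Sum>i\<in>I. a i * c' i x)" for a
    using assms by (intro ext sum.cong) auto
  then show ?thesis unfolding lspan_def by presburger
qed

lemma lspan_base:
  assumes "finite I" "i \<in> I"
  shows "c i \<in> lspan I c"
proof (rule lspanI)
  fix x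
  have "(\<Sum>k\<in>I. (if k = i then 1 else 0) * c k x) = (\<Sum>k\<in>I. if k = i then c k x else 0)"
    by (rule sum.cong) auto
  then show "c i x = (\<Sum>k\<in>I. (if k = i then 1 else 0) * c k x)"
    using assms by simp
qed

lemma lspan_lincomb:
  assumes "u \<in> lspan I c" "v \<in> lspan I c"
  shows "(\<lambda>x. p * u x + q * v x) \<in> lspan I c"
proof -
  from assms obtain a b where "u = (\<lambda>x. \<Sum>i\<in>I. a i * c i x)" "v = (\<lambda>x. \<Sum>i\<in>I. b i * c i x)"
    by (elim lspanE)
  then have "p * u x + q * v x = (\<Sum>i\<in>I. (p * a i + q * b i) * c i x)" for x
    by (simp add: sum_distrib_left sum.distrib algebra_simps)
  then show ?thesis by (rule lspanI)
qed

lemma lspan_zero: "(\<lambda>x. 0) \<in> lspan I c"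
  by (rule lspanI[where a = "\<lambda>_. 0"]) simp

lemma lspan_sum:
  assumes "\<And>j. j \<in> J \<Longrightarrow> f j \<in> lspan I c"
  shows "(\<lambda>x. \<Sum>j\<in>J. a j * f j x) \<in> lspan I c"
proof (cases "finite J")
  case True
  then show ?thesis using assms
  proof (induction J)
    case empty
    then show ?case by (simp add: lspan_zero)
  next
    case (insert j J)
    then have "(\<lambda>x. a j * f j x + 1 * (\<Sum>j\<in>J. a j * f j x)) \<in> lspan I c"
      by (intro lspan_lincomb) auto
    with insert show ?case by simp
  qed
qed (simp add: lspan_zero)

lemma lspan_subset:
  assumes "\<And>j. j \<in> J \<Longrightarrow> f j \<in> lspan I c"
  shows "lspan J f \<subseteq> lspan I c"
  using lspan_sum[of J f, OF assms] by (auto elim!: lspanE)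

lemma lspan_mono:
  assumes "finite J" "I \<subseteq> J"
  shows "lspan I c \<subseteq> lspan J c"
  using assms by (intro lspan_subset lspan_base) auto

section \<open>Unimodular changes of a spanning family\<close>

lemma lspan_combine2:
  assumes "finite I" "i \<in> I" "j \<in> I" "i \<noteq> j" and det: "p * t - q * u = 1"
  shows "lspan I (c(i := (\<lambda>x. p * c i x + q * c j x), j := (\<lambda>x. u * c i x + t * c j x))) = lspan I c"
    (is "lspan I ?c = _")
proof
  show "lspan I ?c \<subseteq> lspan I c"
    using assms by (intro lspan_subset) (auto intro!: lspan_base lspan_lincomb)
  have B: "k \<in> I \<Longrightarrow> ?c k \<in> lspan I ?c" for k
    using assms(1) by (rule lspan_base)
  \<comment> \<open>The matrix with rows \<open>(p, q)\<close> and \<open>(u, t)\<close> has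
    determinant 1; the rows \<open>(t, -q)\<close> and \<open>(-u, p)\<close> of its inverse recover
    the old members.\<close>
  have "(\<lambda>x. t * ?c i x + (- q) * ?c j x) = c i"
  proof
    fix x
    have "t * ?c i x + (- q) * ?c j x = (p * t - q * u) * c i x"
      using \<open>i \<noteq> j\<close> by (simp add: algebra_simps)
    then show "t * ?c i x + (- q) * ?c j x = c i x" using det by simp
  qed
  then have ci: "c i \<in> lspan I ?c"
    using lspan_lincomb[OF B B, of i j t "- q"] assms by auto
  have "(\<lambda>x. (- u) * ?c i x + p * ?c j x) = c j"
  proof
    fix x
    have "(- u) * ?c i x + p * ?c j x = (p * t - q * u) * c j x"
      using \<open>i \<noteq> j\<close> by (simp add: algebra_simps)
    then show "(- u) * ?c i x + p * ?c j x = c j x" using det by simp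
  qed
  then have cj: "c j \<in> lspan I ?c"
    using lspan_lincomb[OF B B, of i j "- u" p] assms by auto
  show "lspan I c \<subseteq> lspan I ?c"
  proof (rule lspan_subset)
    fix k assume "k \<in> I"
    then show "c k \<in> lspan I ?c"
      using ci cj B[of k] by (cases "k = i"; cases "k = j") auto
  qed
qed

definition lin_fun :: "(('x \<Rightarrow> 'r :: comm_ring_1) \<Rightarrow> 'r) \<Rightarrow> bool" where
  "lin_fun \<phi> \<longleftrightarrow> (\<forall>a f b g. \<phi> (\<lambda>x. a * f x + b * g x) = a * \<phi> f + b * \<phi> g)"

lemma lin_funD: "lin_fun \<phi> \<Longrightarrow> \<phi> (\<lambda>x. a * f x + b * g x) = a * \<phi> f + b * \<phi> g"
  unfolding lin_fun_def by blast

lemma lin_fun_sum: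
  assumes "lin_fun \<phi>"
  shows "\<phi> (\<lambda>x. \<Sum>i\<in>I. a i * c i x) = (\<Sum>i\<in>I. a i * \<phi> (c i))"
proof -
  have z: "\<phi> (\<lambda>x. 0) = 0"
    using lin_funD[OF assms, of 0 "\<lambda>x. 0" 0 "\<lambda>x. 0"] by simp
  show ?thesis
  proof (cases "finite I")
    case True
    then show ?thesis
    proof (induction I)
      case empty
      then show ?case by (simp add: z)
    next
      case (insert i I)
      have "\<phi> (\<lambda>x. a i * c i x + 1 * (\<Sum>i\<in>I. a i * c i x))
          = a i * \<phi> (c i) + 1 * \<phi> (\<lambda>x. \<Sum>i\<in>I. a i * c i x)"
        by (rule lin_funD[OF assms])
      with insert show ?case by simp
    qed
  qed (simp add: z)
qed

lemma lin_fun_weighted_sum: "lin_fun (\<lambda>v. \<Sum>x\<in>X. w x * v x)"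
  by (simp add: lin_fun_def sum.distrib sum_distrib_left algebra_simps)

text \<open>Euclid's algorithm by column operations: the value at index 0 becomes, up to sign, the
  gcd of the values met so far, and the others become 0.\<close>

lemma ex_lspan_single_value:
  fixes \<phi> :: "('x \<Rightarrow> int) \<Rightarrow> int" and D :: nat
  assumes lin: "lin_fun \<phi>"
  shows "\<exists>c'. lspan {..<D} c' = lspan {..<D} c \<and> (\<forall>k. 0 < k \<and> k < D \<longrightarrow> \<phi> (c' k) = 0)"
proof (induction D)
  case 0
  show ?case by auto
next
  case (Suc D)
  then obtain c1 where c1: "lspan {..<D} c1 = lspan {..<D} c"
    and c1z: "\<And>k. 0 < k \<Longrightarrow> k < D \<Longrightarrow> \<phi> (c1 k) = 0" by auto
  \<comment> \<open>The induction hypothesis says nothing about \<open>c1 D\<close>, so the original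
    last member is put back.\<close>
  define c2 where "c2 = c1(D := c D)"
  have sub: "lspan {..<Suc D} e' \<subseteq> lspan {..<Suc D} e"
    if "lspan {..<D} e' = lspan {..<D} e" "e' D = e D" for e e' :: "nat \<Rightarrow> 'x \<Rightarrow> int"
  proof (rule lspan_subset)
    fix k assume "k \<in> {..<Suc D}"
    then consider "k < D" | "k = D" by force
    then show "e' k \<in> lspan {..<Suc D} e"
    proof cases
      case 1
      then have "e' k \<in> lspan {..<D} e'" by (simp add: lspan_base)
      with that(1) show ?thesis using lspan_mono[of "{..<Suc D}" "{..<D}" e] by auto
    next
      case 2
      then show ?thesis using lspan_base[of "{..<Suc D}" D e] that(2) by simp
    qed
  qed
  have "lspan {..<D} c2 = lspan {..<D} c1"
    by (rule lspan_cong) (simp add: c2_def)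
  then have c2: "lspan {..<Suc D} c2 = lspan {..<Suc D} c"
    using c1 by (intro equalityI sub) (simp_all add: c2_def)
  have c2z: "\<phi> (c2 k) = 0" if "0 < k" "k < D" for k
    using c1z that by (simp add: c2_def)
  define g where "g = gcd (\<phi> (c2 0)) (\<phi> (c2 D))"
  show ?case
  proof (cases "D = 0 \<or> g = 0")
    case True
    then show ?thesis
      using c2 c2z by (intro exI[of _ c2]) (auto simp: g_def less_Suc_eq)
  next
    case False
    obtain p q where pq: "p * \<phi> (c2 0) + q * \<phi> (c2 D) = g"
      unfolding g_def using bezout_int by blast
    obtain a b where a: "\<phi> (c2 0) = g * a" and b: "\<phi> (c2 D) = g * b"
      by (metis g_def gcd_dvd1 gcd_dvd2 dvd_def)
    \<comment> \<open>Cancelling the gcd in the Bezout identity gives the determinant of the change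
      that replaces the values \<open>g * a\<close> and \<open>g * b\<close> by \<open>g\<close> and
      0.\<close>
    have "g * (p * a + q * b) = g * 1"
      using pq by (simp add: a b algebra_simps)
    then have "p * a - q * (- b) = 1"
      using False by simp
    define c3 where "c3 = c2(0 := (\<lambda>x. p * c2 0 x + q * c2 D x), D := (\<lambda>x. (- b) * c2 0 x + a * c2 D x))"
    have "lspan {..<Suc D} c3 = lspan {..<Suc D} c2"
      unfolding c3_def using \<open>p * a - q * (- b) = 1\<close> False by (intro lspan_combine2) auto
    moreover have "\<phi> (\<lambda>x. (- b) * c2 0 x + a * c2 D x) = 0"
      unfolding lin_funD[OF lin] a b by simp
    then have "\<phi> (c3 k) = 0" if "0 < k" "k < Suc D" for k
      using that c2z by (cases "k = D") (auto simp: c3_def)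
    ultimately show ?thesis
      using c2 by (intro exI[of _ c3]) simp
  qed
qed

text \<open>After Euclid's algorithm only the value \<open>g\<close> at index 0 is left, and
  \<open>v\<close> shows that \<open>g\<close> is a unit modulo \<open>y\<close>. A second member,
  of value 0, helps to turn this unit into 1; a single member allows only a change of sign.\<close>

lemma ex_lspan_unit_value:
  fixes \<phi> :: "('x \<Rightarrow> int) \<Rightarrow> int" and D :: nat
  assumes lin: "lin_fun \<phi>" and D: "1 < D \<or> D = 1 \<and> (y = 0 \<or> y = 2)"
    and v: "v \<in> lspan {..<D} c" "y dvd \<phi> v - 1"
  shows "\<exists>c'. lspan {..<D} c' = lspan {..<D} c \<and> (\<forall>k<D. y dvd \<phi> (c' k) - (if k = 0 then 1 else 0))"
proof -
  obtain c1 where c1: "lspan {..<D} c1 = lspan {..<D} c"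
    and z: "\<And>k. 0 < k \<Longrightarrow> k < D \<Longrightarrow> \<phi> (c1 k) = 0"
    using ex_lspan_single_value[OF lin, of D c] by blast
  define g where "g = \<phi> (c1 0)"
  obtain a where a: "v = (\<lambda>x. \<Sum>i\<in>{..<D}. a i * c1 i x)"
    using v(1) unfolding c1[symmetric] by (rule lspanE)
  have "\<phi> v = (\<Sum>i<D. a i * \<phi> (c1 i))"
    unfolding a lin_fun_sum[OF lin] ..
  also have "\<dots> = (\<Sum>i<D. if i = 0 then a 0 * g else 0)"
    by (rule sum.cong) (use z in \<open>auto simp: g_def\<close>)
  also have "\<dots> = a 0 * g" using D by auto
  finally have "y dvd a 0 * g - 1" using v(2) by simp
  then obtain k where "a 0 * g - 1 = y * k" by (elim dvdE)
  then have "a 0 * g + (- k) * y = 1" by (simp add: algebra_simps)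
  then obtain q where q: "a 0 * g + q * y = 1" by blast
  show ?thesis
  proof (cases "1 < D")
    case True
    \<comment> \<open>The rows \<open>(a 0, q)\<close> and \<open>(-y, g)\<close> have determinant
      \<open>a 0 * g + q * y = 1\<close> and turn the values \<open>(g, 0)\<close> into
      \<open>(a 0 * g, - y * g)\<close>, which is \<open>(1, 0)\<close> modulo
      \<open>y\<close>.\<close>
    let ?c = "c1(0 := (\<lambda>x. a 0 * c1 0 x + q * c1 1 x), 1 := (\<lambda>x. (- y) * c1 0 x + g * c1 1 x))"
    have "lspan {..<D} ?c = lspan {..<D} c1"
      using True q by (intro lspan_combine2) auto
    moreover have "y dvd \<phi> (?c k) - (if k = 0 then 1 else 0)" if "k < D" for k
    proof -
      consider "k = 0" | "k = 1" | "1 < k" by linarith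
      then show ?thesis
      proof cases
        case 1
        then have "\<phi> (?c k) - 1 = y * (- q)"
          using q True by (simp add: lin_funD[OF lin] z g_def[symmetric] algebra_simps)
        then show ?thesis using 1 by simp
      next
        case 2
        then show ?thesis using True by (simp add: lin_funD[OF lin, of "- y", simplified] z)
      next
        case 3
        then show ?thesis using that by (simp add: z)
      qed
    qed
    ultimately show ?thesis using c1 by blast
  next
    case False
    with D have D1: "D = 1" and y: "y = 0 \<or> y = 2" by auto
    \<comment> \<open>A unit modulo 0 is 1 or -1, and a unit modulo 2 is odd, so a sign is
      enough.\<close>
    have "\<exists>e. (e = 1 \<or> e = -1) \<and> y dvd e * g - 1"
    proof (cases "y = 0")
      case True
      then have "a 0 * g = 1" using q by simp
      then have "g = 1 \<or> g = -1" by (metis zmult_eq_1_iff)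
      then show ?thesis by (intro exI[of _ g]) auto
    next
      case False
      then have "y = 2" using y by simp
      then have "odd g" using q by (metis dvd_triv_right even_add even_mult_iff odd_one)
      then show ?thesis using False y by (intro exI[of _ 1]) auto
    qed
    then obtain e where e: "e = 1 \<or> e = -1" "y dvd e * g - 1" by blast
    let ?c = "\<lambda>k::nat. \<lambda>x. e * c1 0 x + 0 * c1 0 x"
    have "lspan {..<D} ?c = lspan {..<D} c1"
    proof
      show "lspan {..<D} ?c \<subseteq> lspan {..<D} c1"
        using D1 by (intro lspan_subset lspan_lincomb lspan_base) auto
      have "c1 0 = (\<lambda>x. e * ?c 0 x + 0 * ?c 0 x)" using e(1) by auto
      also have "\<dots> \<in> lspan {..<D} ?c"
        using D1 by (intro lspan_lincomb lspan_base) auto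
      finally show "lspan {..<D} c1 \<subseteq> lspan {..<D} ?c"
        using D1 by (intro lspan_subset) auto
    qed
    moreover have "\<phi> (?c 0) = e * g"
      unfolding lin_funD[OF lin] g_def by simp
    ultimately show ?thesis
      using c1 e D1 by (intro exI[of _ ?c]) auto
  qed
qed


text \<open>
  The hypothesis on \<open>d\<close>, \<open>D\<close> and \<open>y\<close> cannot simply be weakened to \<open>d \<le> D\<close>: for \<open>d = D\<close> the determinant
  of the matrix \<open>\<phi> j (c k)\<close> would have to be \<open>\<plusminus>1\<close> modulo \<open>y\<close>, and for \<open>y = 0\<close> or \<open>y = 2\<close> every unit is.
\<close>

lemma ex_lspan_dual_mod:
  fixes \<phi> :: "nat \<Rightarrow> ('x \<Rightarrow> int) \<Rightarrow> int" and y :: "nat \<Rightarrow> int" and D :: nat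
  assumes "\<And>j. lin_fun (\<phi> j)"
    and "d < D \<or> d \<le> D \<and> (\<forall>j<d. y j = 0 \<or> y j = 2)"
    and "\<And>j. Suc j < d \<Longrightarrow> y (Suc j) dvd y j"
    and "\<And>i. i < d \<Longrightarrow> \<exists>v\<in>lspan {..<D} c. \<forall>j<d. y j dvd \<phi> j v - (if j = i then 1 else 0)"
  shows "\<exists>c'. lspan {..<D} c' = lspan {..<D} c \<and>
    (\<forall>k<D. \<forall>j<d. y j dvd \<phi> j (c' k) - (if j = k then 1 else 0))"
  using assms
proof (induction d arbitrary: D c \<phi> y)
  case 0
  then show ?case by auto
next
  case (Suc d)
  note lin = Suc.prems(1) and D = Suc.prems(2) and chain = Suc.prems(3) and surj = Suc.prems(4)
  obtain D' where D': "D = Suc D'" using D by (cases D) auto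
  obtain v where "v \<in> lspan {..<D} c" "y 0 dvd \<phi> 0 v - 1"
    using surj[of 0] by auto
  moreover have "1 < D \<or> D = 1 \<and> (y 0 = 0 \<or> y 0 = 2)"
    using D by auto
  ultimately have "\<exists>c2. lspan {..<D} c2 = lspan {..<D} c \<and>
      (\<forall>k<D. y 0 dvd \<phi> 0 (c2 k) - (if k = 0 then 1 else 0))"
    by (intro ex_lspan_unit_value[OF lin])
  then obtain c2 where c2: "lspan {..<D} c2 = lspan {..<D} c"
    and c2y: "\<And>k. k < D \<Longrightarrow> y 0 dvd \<phi> 0 (c2 k) - (if k = 0 then 1 else 0)"
    by blast
  \<comment> \<open>\<open>y 0\<close> is a multiple of all the moduli, so whatever vanishes modulo
    \<open>y 0\<close> vanishes modulo each of them.\<close>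
  have y0: "y j dvd y 0" if "j < Suc d" for j
    using that by (induction j) (auto intro: dvd_trans chain)
  define c3 where "c3 = (\<lambda>k. c2 (Suc k))"
  have c3y: "y 0 dvd \<phi> 0 (c3 k)" if "k < D'" for k
    using c2y[of "Suc k"] that by (simp add: c3_def D')
  have c20: "y 0 dvd \<phi> 0 (c2 0) - 1"
    using c2y[of 0] by (simp add: D')
  have "\<exists>c'. lspan {..<D'} c' = lspan {..<D'} c3 \<and>
    (\<forall>k<D'. \<forall>j<d. y (Suc j) dvd \<phi> (Suc j) (c' k) - (if j = k then 1 else 0))"
  proof (rule Suc.IH[where \<phi> = "\<lambda>j. \<phi> (Suc j)" and y = "\<lambda>j. y (Suc j)"])
    show "lin_fun (\<phi> (Suc j))" for j by (rule lin)
    show "d < D' \<or> d \<le> D' \<and> (\<forall>j<d. y (Suc j) = 0 \<or> y (Suc j) = 2)"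
      using D by (auto simp: D')
    show "y (Suc (Suc j)) dvd y (Suc j)" if "Suc j < d" for j
      using chain that by simp
    fix i assume "i < d"
    then obtain v where vc: "v \<in> lspan {..<D} c2"
      and vy: "\<And>j. j < Suc d \<Longrightarrow> y j dvd \<phi> j v - (if j = Suc i then 1 else 0)"
      using surj[of "Suc i"] c2 by auto
    from vc obtain a where v: "v = (\<lambda>x. \<Sum>k<D. a k * c2 k x)" by (rule lspanE)
    \<comment> \<open>Dropping the component along \<open>c2 0\<close> is harmless: its coefficient
      \<open>a 0\<close> turns out to be divisible by \<open>y 0\<close>.\<close>
    define v' where "v' = (\<lambda>x. \<Sum>k<D'. a (Suc k) * c3 k x)"
    have \<phi>v: "\<phi> j v = a 0 * \<phi> j (c2 0) + \<phi> j v'" for j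
      unfolding v v'_def lin_fun_sum[OF lin] c3_def by (simp add: D' sum.lessThan_Suc_shift del: sum.lessThan_Suc)
    have "y 0 dvd \<phi> 0 v'"
      unfolding v'_def lin_fun_sum[OF lin] using c3y by (intro dvd_sum dvd_mult) auto
    moreover have "y 0 dvd \<phi> 0 v" using vy[of 0] by simp
    moreover have "a 0 = \<phi> 0 v - \<phi> 0 v' - a 0 * (\<phi> 0 (c2 0) - 1)"
      by (simp add: \<phi>v algebra_simps)
    ultimately have a0: "y 0 dvd a 0"
      using c20 by (metis dvd_diff dvd_mult)
    have "y (Suc j) dvd \<phi> (Suc j) v' - (if j = i then 1 else 0)" if "j < d" for j
    proof -
      have "\<phi> (Suc j) v' - (if j = i then 1 else 0)
          = (\<phi> (Suc j) v - (if Suc j = Suc i then 1 else 0)) - a 0 * \<phi> (Suc j) (c2 0)"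
        by (simp add: \<phi>v)
      then show ?thesis
        using vy[of "Suc j"] that a0 y0[of "Suc j"] by (metis Suc_less_eq dvd_diff dvd_mult2 dvd_trans)
    qed
    then show "\<exists>v\<in>lspan {..<D'} c3. \<forall>j<d. y (Suc j) dvd \<phi> (Suc j) v - (if j = i then 1 else 0)"
      by (intro bexI[of _ v']) (auto simp: v'_def intro: lspanI)
  qed
  then obtain c4 where c4: "lspan {..<D'} c4 = lspan {..<D'} c3"
    and c4y: "\<And>k j. k < D' \<Longrightarrow> j < d \<Longrightarrow> y (Suc j) dvd \<phi> (Suc j) (c4 k) - (if j = k then 1 else 0)"
    by blast
  have c4y0: "y 0 dvd \<phi> 0 (c4 k)" if "k < D'" for k
  proof -
    have "c4 k \<in> lspan {..<D'} c3" using that c4 lspan_base[of "{..<D'}" k c4] by auto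
    then obtain a where a: "c4 k = (\<lambda>x. \<Sum>k<D'. a k * c3 k x)" by (rule lspanE)
    show ?thesis unfolding a lin_fun_sum[OF lin] using c3y by (intro dvd_sum dvd_mult) auto
  qed
  \<comment> \<open>\<open>c4\<close> is dual to the remaining functionals modulo their moduli, so
    subtracting \<open>w\<close> clears their values on \<open>c2 0\<close>. The first functional
    vanishes on \<open>w\<close> modulo \<open>y 0\<close>, so its value 1 survives.\<close>
  define w where "w = (\<lambda>x. \<Sum>l<d. \<phi> (Suc l) (c2 0) * c4 l x)"
  define c' where "c' = (\<lambda>k. case k of 0 \<Rightarrow> (\<lambda>x. 1 * c2 0 x + (-1) * w x) | Suc k \<Rightarrow> c4 k)"
  have dD: "d \<le> D'" using D by (auto simp: D')
  have w4: "w \<in> lspan {..<D'} c4"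
    unfolding w_def using dD by (intro lspan_sum lspan_base) auto
  have shift: "lspan {..<D'} (\<lambda>k. e (Suc k)) \<subseteq> lspan {..<D} e" for e :: "nat \<Rightarrow> 'x \<Rightarrow> int"
    by (rule lspan_subset, rule lspan_base) (auto simp: D')
  have shift_eq: "lspan {..<D} e \<subseteq> lspan {..<D} e'"
    if "e 0 \<in> lspan {..<D} e'" "lspan {..<D'} (\<lambda>k. e (Suc k)) \<subseteq> lspan {..<D} e'"
    for e e' :: "nat \<Rightarrow> 'x \<Rightarrow> int"
  proof (rule lspan_subset)
    fix k assume "k \<in> {..<D}"
    then show "e k \<in> lspan {..<D} e'"
      using that lspan_base[of "{..<D'}" "k - 1" "\<lambda>k. e (Suc k)"] by (cases k) (auto simp: D')
  qed
  have c'4: "(\<lambda>k. c' (Suc k)) = c4" by (simp add: c'_def)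
  have "lspan {..<D} c' = lspan {..<D} c2"
  proof
    have s: "lspan {..<D'} c4 \<subseteq> lspan {..<D} c2"
      using shift[of c2] c4 by (simp add: c3_def)
    show "lspan {..<D} c' \<subseteq> lspan {..<D} c2"
    proof (rule shift_eq)
      have "(\<lambda>x. 1 * c2 0 x + (-1) * w x) \<in> lspan {..<D} c2"
        using s w4 by (intro lspan_lincomb lspan_base) (auto simp: D')
      then show "c' 0 \<in> lspan {..<D} c2" by (simp add: c'_def)
    qed (use s c'4 in simp)
    have s': "lspan {..<D'} c4 \<subseteq> lspan {..<D} c'"
      using shift[of c'] c'4 by simp
    show "lspan {..<D} c2 \<subseteq> lspan {..<D} c'"
    proof (rule shift_eq)
      have "(\<lambda>x. 1 * c' 0 x + 1 * w x) \<in> lspan {..<D} c'"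
        using s' w4 by (intro lspan_lincomb lspan_base) (auto simp: D')
      then show "c2 0 \<in> lspan {..<D} c'" by (simp add: c'_def)
    qed (use s' c4 in \<open>simp add: c3_def\<close>)
  qed
  moreover have "y j dvd \<phi> j (c' k) - (if j = k then 1 else 0)" if k: "k < D" and j: "j < Suc d" for k j
  proof (cases k)
    case (Suc k')
    then show ?thesis
      using k j c4y c4y0 by (cases j) (auto simp: c'_def D')
  next
    case 0
    have val: "\<phi> j (c' 0) = \<phi> j (c2 0) - (\<Sum>l<d. \<phi> (Suc l) (c2 0) * \<phi> j (c4 l))"
      unfolding c'_def nat.case lin_funD[OF lin] w_def lin_fun_sum[OF lin] by simp
    show ?thesis
    proof (cases j)
      case j0: 0
      have "y 0 dvd (\<Sum>l<d. \<phi> (Suc l) (c2 0) * \<phi> 0 (c4 l))"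
        using c4y0 dD by (intro dvd_sum dvd_mult) auto
      then have "y 0 dvd (\<phi> 0 (c2 0) - 1) - (\<Sum>l<d. \<phi> (Suc l) (c2 0) * \<phi> 0 (c4 l))"
        using c20 by (rule dvd_diff[rotated])
      moreover have "\<phi> 0 (c2 0) - 1 - (\<Sum>l<d. \<phi> (Suc l) (c2 0) * \<phi> 0 (c4 l)) = \<phi> 0 (c' 0) - 1"
        using val j0 by simp
      ultimately show ?thesis using 0 j0 by simp
    next
      case (Suc j')
      with j have j': "j' < d" by simp
      have "(\<Sum>l<d. \<phi> (Suc l) (c2 0) * (if j' = l then 1 else 0))
          = (\<Sum>l<d. if j' = l then \<phi> (Suc l) (c2 0) else 0)"
        by (rule sum.cong) auto
      also have "\<dots> = \<phi> (Suc j') (c2 0)" using j' by simp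
      finally have "\<phi> j (c' 0)
          = (\<Sum>l<d. \<phi> (Suc l) (c2 0) * ((if j' = l then 1 else 0) - \<phi> j (c4 l)))"
        unfolding val by (simp add: Suc sum_subtractf right_diff_distrib)
      also have "y j dvd \<dots>"
      proof (intro dvd_sum dvd_mult)
        fix l assume "l \<in> {..<d}"
        then have "y j dvd \<phi> j (c4 l) - (if j' = l then 1 else 0)"
          using c4y[of l j'] j' dD Suc by simp
        then show "y j dvd (if j' = l then 1 else 0) - \<phi> j (c4 l)"
          by (metis dvd_minus_iff minus_diff_eq)
      qed
      finally show ?thesis using 0 Suc by simp
    qed
  qed
  ultimately show ?case using c2 by blast
qed

section \<open>Square matrices and bases\<close>

lemma mat_right_inverse_imp_left_inverse:
  fixes A :: "'r :: comm_ring_1 mat"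
  assumes A: "A \<in> carrier_mat n n" and B: "B \<in> carrier_mat n n" and AB: "A * B = 1\<^sub>m n"
  shows "B * A = 1\<^sub>m n"
proof -
  note adj = adj_mat[OF A]
  have d: "det B * det A = 1"
    using det_mult[OF A B] AB by (simp add: mult.commute)
  \<comment> \<open>The adjugate replaces division: it equals \<open>det A\<close> times
    \<open>B\<close>, and \<open>det A\<close> is a unit with inverse \<open>det B\<close>.\<close>
  have "adj_mat A * (A * B) = adj_mat A * A * B"
    using adj A B by (intro assoc_mult_mat[symmetric]) auto
  also have "\<dots> = det A \<cdot>\<^sub>m B"
    using adj A B by (simp add: mult_smult_assoc_mat[of _ n n _ n])
  finally have "adj_mat A = det A \<cdot>\<^sub>m B"
    using AB adj by simp
  then have "det A \<cdot>\<^sub>m (B * A) = det A \<cdot>\<^sub>m 1\<^sub>m n"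
    using adj(3) A B by (simp add: mult_smult_assoc_mat[of _ n n _ n])
  then have "det B \<cdot>\<^sub>m (det A \<cdot>\<^sub>m (B * A)) = det B \<cdot>\<^sub>m (det A \<cdot>\<^sub>m 1\<^sub>m n)"
    by simp
  moreover have "det B \<cdot>\<^sub>m (det A \<cdot>\<^sub>m C) = C" for C
    using d by (intro eq_matI) (auto simp: mult.assoc[symmetric])
  ultimately show ?thesis by simp
qed

text \<open>The coefficients that express the point masses through the family form a right inverse,
  and for square matrices this is also a left inverse.\<close>

lemma spanning_family_matrix_inverse:
  fixes c :: "'k \<Rightarrow> 'x \<Rightarrow> 'r :: comm_ring_1"
  assumes "distinct es" "distinct ks" "length es = N" "length ks = N"
    and span: "\<And>x. x \<in> set es \<Longrightarrow> (\<lambda>x'. if x' = x then 1 else 0) \<in> lspan (set ks) c"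
  obtains G where "G \<in> carrier_mat N N"
    "mat N N (\<lambda>(i, k). c (ks ! k) (es ! i)) * G = 1\<^sub>m N"
    "G * mat N N (\<lambda>(i, k). c (ks ! k) (es ! i)) = 1\<^sub>m N"
proof -
  have "\<forall>x\<in>set es. \<exists>a. (\<lambda>x'. if x' = x then 1 else 0) = (\<lambda>x'. \<Sum>k\<in>set ks. a k * c k x')"
    using span unfolding lspan_def by auto
  from bchoice[OF this] obtain a where
    "\<forall>x\<in>set es. (\<lambda>x'. if x' = x then 1 else 0) = (\<lambda>x'. \<Sum>k\<in>set ks. a x k * c k x')" ..
  then have a: "(if x' = x then 1 else 0) = (\<Sum>k\<in>set ks. a x k * c k x')" if "x \<in> set es" for x x'
    using that fun_cong[of "\<lambda>x'. if x' = x then 1 else 0" _ x'] by blast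
  define G where "G = mat N N (\<lambda>(k, i). a (es ! i) (ks ! k))"
  let ?B = "mat N N (\<lambda>(i, k). c (ks ! k) (es ! i))"
  have bij: "bij_betw (\<lambda>k. ks ! k) {..<N} (set ks)"
    using assms by (intro bij_betw_nth) auto
  have "?B * G = 1\<^sub>m N"
  proof (rule eq_matI)
    fix i j assume ij: "i < dim_row (1\<^sub>m N)" "j < dim_col (1\<^sub>m N)"
    then have "(?B * G) $$ (i, j) = (\<Sum>k<N. c (ks ! k) (es ! i) * a (es ! j) (ks ! k))"
      by (simp add: G_def scalar_prod_def lessThan_atLeast0)
    also have "\<dots> = (\<Sum>k\<in>set ks. c k (es ! i) * a (es ! j) k)"
      by (rule sum.reindex_bij_betw[OF bij])
    also have "\<dots> = (if es ! i = es ! j then 1 else 0)"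
      using a[of "es ! j" "es ! i"] ij assms by (simp add: mult.commute)
    also have "\<dots> = 1\<^sub>m N $$ (i, j)"
      using ij assms by (simp add: nth_eq_iff_index_eq)
    finally show "(?B * G) $$ (i, j) = 1\<^sub>m N $$ (i, j)" .
  qed (auto simp: G_def)
  moreover have "G \<in> carrier_mat N N" by (simp add: G_def)
  ultimately show ?thesis
    using that mat_right_inverse_imp_left_inverse[of ?B N G] by auto
qed

text \<open>A spanning family of the right size is a basis: the left inverse of its matrix turns a
  relation into the vanishing of its coefficients.\<close>

lemma spanning_family_independent:
  fixes c :: "'k \<Rightarrow> 'x \<Rightarrow> 'r :: comm_ring_1"
  assumes fin: "finite X" "finite K" and card: "card K = card X"
    and span: "\<And>x. x \<in> X \<Longrightarrow> (\<lambda>x'. if x' = x then 1 else 0) \<in> lspan K c"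
    and zero: "\<And>x. x \<in> X \<Longrightarrow> (\<Sum>k\<in>K. a k * c k x) = 0" and k: "k \<in> K"
  shows "a k = 0"
proof -
  obtain es ks where es: "set es = X" "distinct es" and ks: "set ks = K" "distinct ks"
    using fin finite_distinct_list by metis
  define N where "N = card X"
  have len: "length es = N" "length ks = N"
    using es ks card by (auto simp: N_def distinct_card[symmetric])
  let ?B = "mat N N (\<lambda>(i, k). c (ks ! k) (es ! i))"
  obtain G where G: "G \<in> carrier_mat N N" "G * ?B = 1\<^sub>m N"
    using spanning_family_matrix_inverse[of es ks N c] es ks len span by blast
  define v where "v = vec N (\<lambda>k. a (ks ! k))"
  have bij: "bij_betw (\<lambda>k. ks ! k) {..<N} K"
    using ks len by (intro bij_betw_nth) auto
  have "?B *\<^sub>v v = 0\<^sub>v N"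
  proof (rule eq_vecI)
    fix i assume i: "i < dim_vec (0\<^sub>v N)"
    then have "(?B *\<^sub>v v) $ i = (\<Sum>k<N. c (ks ! k) (es ! i) * a (ks ! k))"
      by (simp add: v_def scalar_prod_def lessThan_atLeast0)
    also have "\<dots> = (\<Sum>k\<in>K. c k (es ! i) * a k)"
      by (rule sum.reindex_bij_betw[OF bij])
    also have "\<dots> = 0"
      using zero[of "es ! i"] i es len by (auto simp: mult.commute)
    finally show "(?B *\<^sub>v v) $ i = 0\<^sub>v N $ i" using i by simp
  qed simp
  then have "(G * ?B) *\<^sub>v v = 0\<^sub>v N"
    using G by (subst assoc_mult_mat_vec[of _ N N _ N]) (auto simp: v_def)
  then have "v = 0\<^sub>v N" using G by (simp add: v_def)
  moreover obtain i where "i < N" "ks ! i = k"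
    using k ks len by (metis in_set_conv_nth)
  ultimately show ?thesis
    by (metis v_def index_vec index_zero_vec(1))
qed

text \<open>\<open>\<beta>\<close> is the basis of the source and \<open>\<gamma>\<close> that of
  the target in which \<open>M\<close> is diagonal with entries \<open>s\<close>. The base changes
  are invertible by counting.\<close>

lemma has_smith_normal_form_from_spanning_families:
  fixes M :: "'r :: comm_ring_1 mat"
  assumes M: "M \<in> carrier_mat N N"
    and lists: "distinct es" "distinct ks" "length es = N" "length ks = N"
    and \<beta>: "\<And>x. x \<in> set es \<Longrightarrow> (\<lambda>x'. if x' = x then 1 else 0) \<in> lspan (set ks) \<beta>"
    and \<gamma>: "\<And>x. x \<in> set es \<Longrightarrow> (\<lambda>x'. if x' = x then 1 else 0) \<in> lspan (set ks) \<gamma>"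
    and eq: "\<And>i k. i < N \<Longrightarrow> k \<in> set ks \<Longrightarrow> (\<Sum>j<N. M $$ (i, j) * \<beta> k (es ! j)) = s k * \<gamma> k (es ! i)"
    and dvd: "\<And>i. Suc i < N \<Longrightarrow> s (ks ! i) dvd s (ks ! Suc i)"
  shows "has_smith_normal_form M"
proof -
  let ?B = "mat N N (\<lambda>(i, k). \<beta> (ks ! k) (es ! i))"
  let ?C = "mat N N (\<lambda>(i, k). \<gamma> (ks ! k) (es ! i))"
  let ?S = "mat N N (\<lambda>(i, k). if i = k then s (ks ! k) else 0)"
  obtain G where G: "G \<in> carrier_mat N N" "?B * G = 1\<^sub>m N" "G * ?B = 1\<^sub>m N"
    using spanning_family_matrix_inverse[OF lists \<beta>] by blast
  obtain H where H: "H \<in> carrier_mat N N" "?C * H = 1\<^sub>m N" "H * ?C = 1\<^sub>m N"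
    using spanning_family_matrix_inverse[OF lists \<gamma>] by blast
  have "M * ?B = ?C * ?S"
  proof (rule eq_matI)
    fix i k assume ik: "i < dim_row (?C * ?S)" "k < dim_col (?C * ?S)"
    then have "(M * ?B) $$ (i, k) = s (ks ! k) * \<gamma> (ks ! k) (es ! i)"
      using eq[of i "ks ! k"] M lists by (simp add: scalar_prod_def lessThan_atLeast0)
    also have "\<dots> = (\<Sum>l = 0..<N. if l = k then s (ks ! k) * \<gamma> (ks ! k) (es ! i) else 0)"
      using ik by simp
    also have "\<dots> = (\<Sum>l = 0..<N. \<gamma> (ks ! l) (es ! i) * (if l = k then s (ks ! k) else 0))"
      by (rule sum.cong) auto
    also have "\<dots> = (?C * ?S) $$ (i, k)"
      using ik by (simp add: scalar_prod_def)
    finally show "(M * ?B) $$ (i, k) = (?C * ?S) $$ (i, k)" .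
  qed (use M in auto)
  then have "H * M * ?B = H * (?C * ?S)"
    using M H by (simp add: assoc_mult_mat[of _ N N _ N _ N])
  also have "\<dots> = H * ?C * ?S"
    using H by (intro assoc_mult_mat[symmetric]) auto
  also have "\<dots> = ?S"
    using H by simp
  finally have S: "H * M * ?B = ?S" .
  have "invertible_mat H" "invertible_mat ?B"
    using G H unfolding invertible_mat_def inverts_mat_def by (auto intro!: exI)
  then show ?thesis
    unfolding has_smith_normal_form_def using M H S dvd
    by (intro exI[of _ H] exI[of _ ?B]) (auto simp: diagonal_mat_def)
qed

section \<open>Bases adapted to up and down operators\<close>

text \<open>Where an operator sends \<open>L k\<close> to \<open>g k * L k + L (k - 1)\<close>,
  these weights make neighbouring terms cancel, and only the top of the chain survives. It serves
  twice: for the image of \<open>DU\<close> over the integers and for diagonalizing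
  \<open>DU + x\<close>.\<close>

lemma chain_sum:
  fixes L h g :: "nat \<Rightarrow> 'r :: comm_ring_1"
  assumes "i \<le> n" and "\<And>k. i \<le> k \<Longrightarrow> k < n \<Longrightarrow> h (Suc k) = - h k * g k"
  shows "(\<Sum>k=i..n. h k * (g k * L k + (if i < k then L (k - 1) else 0))) = h n * g n * L n"
  using assms
proof (induction n rule: dec_induct)
  case base
  then show ?case by simp
next
  case (step n)
  have "(\<Sum>k=i..Suc n. h k * (g k * L k + (if i < k then L (k - 1) else 0)))
      = h n * g n * L n + h (Suc n) * (g (Suc n) * L (Suc n) + L n)"
    using step by simp
  also have "\<dots> = h (Suc n) * g (Suc n) * L (Suc n)"
    using step.prems[of n] step.hyps by (simp add: algebra_simps)
  finally show ?case .
qed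

text \<open>The linear algebra sees a poset only through this data: \<open>e u z\<close> is the
  covering incidence between neighbouring ranks, and \<open>comm_0\<close> and
  \<open>comm_Suc\<close> are the entries of \<open>DU - UD = R\<close>.\<close>

locale up_down =
  fixes X :: "nat \<Rightarrow> 'v set" and e :: "'v \<Rightarrow> 'v \<Rightarrow> int" and R :: nat and d :: "nat \<Rightarrow> nat"
  assumes finite_X: "finite (X n)"
    and comm_0: "u \<in> X 0 \<Longrightarrow> v \<in> X 0 \<Longrightarrow>
      (\<Sum>z\<in>X (Suc 0). e u z * e v z) = (if u = v then int R else 0)"
    and comm_Suc: "u \<in> X (Suc n) \<Longrightarrow> v \<in> X (Suc n) \<Longrightarrow>
      (\<Sum>z\<in>X (Suc (Suc n)). e u z * e v z) = (\<Sum>z\<in>X n. e z u * e z v) + (if u = v then int R else 0)"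
    and down_surj: "\<exists>f. \<forall>y\<in>X n. (\<Sum>x\<in>X (Suc n). e y x * f x) = g y"
    and card_0: "card (X 0) = d 0"
    and card_Suc: "card (X (Suc n)) = card (X n) + d (Suc n)"
    and d_growth: "d n < d (Suc n) \<or> (n = 0 \<and> R = 2 \<and> d n \<le> d (Suc n))"
begin

text \<open>Zero values outside \<open>X n\<close> make equality of elements the plain equality of
  functions.\<close>

definition V :: "nat \<Rightarrow> ('v \<Rightarrow> int) set" where
  "V n = {f. \<forall>x. x \<notin> X n \<longrightarrow> f x = 0}"

definition up :: "nat \<Rightarrow> ('v \<Rightarrow> int) \<Rightarrow> 'v \<Rightarrow> int" where
  "up n f = (\<lambda>x. if x \<in> X (Suc n) then \<Sum>y\<in>X n. e y x * f y else 0)"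

text \<open>Indexed by its target: \<open>dn n\<close> leads from rank \<open>Suc n\<close> to rank
  \<open>n\<close>, so \<open>dn n\<close> after \<open>up n\<close> is \<open>DU\<close> on rank
  \<open>n\<close>.\<close>

definition dn :: "nat \<Rightarrow> ('v \<Rightarrow> int) \<Rightarrow> 'v \<Rightarrow> int" where
  "dn n f = (\<lambda>y. if y \<in> X n then \<Sum>x\<in>X (Suc n). e y x * f x else 0)"

lemma V_eqI: "f \<in> V n \<Longrightarrow> g \<in> V n \<Longrightarrow> (\<And>x. x \<in> X n \<Longrightarrow> f x = g x) \<Longrightarrow> f = g"
  by (rule ext, case_tac "x \<in> X n") (auto simp: V_def)

lemma V_lincomb: "f \<in> V n \<Longrightarrow> g \<in> V n \<Longrightarrow> (\<lambda>x. a * f x + b * g x) \<in> V n"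
  by (auto simp: V_def)

lemma V_sum: "(\<And>i. i \<in> I \<Longrightarrow> c i \<in> V n) \<Longrightarrow> (\<lambda>x. \<Sum>i\<in>I. a i * c i x) \<in> V n"
  by (auto simp: V_def)

lemma V_lspan: "(\<And>i. i \<in> I \<Longrightarrow> c i \<in> V n) \<Longrightarrow> lspan I c \<subseteq> V n"
  by (auto elim!: lspanE intro: V_sum)

lemma delta_V: "x \<in> X n \<Longrightarrow> (\<lambda>x'. if x' = x then 1 else 0) \<in> V n"
  by (auto simp: V_def)

lemma up_V: "up n f \<in> V (Suc n)"
  by (auto simp: V_def up_def)

lemma dn_V: "dn n f \<in> V n"
  by (auto simp: V_def dn_def)

lemma up_lincomb: "up n (\<lambda>x. a * f x + b * g x) = (\<lambda>x. a * up n f x + b * up n g x)"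
  by (auto simp: up_def sum.distrib sum_distrib_left algebra_simps)

lemma dn_lincomb: "dn n (\<lambda>x. a * f x + b * g x) = (\<lambda>x. a * dn n f x + b * dn n g x)"
  by (auto simp: dn_def sum.distrib sum_distrib_left algebra_simps)

lemma up_sum: "up n (\<lambda>x. \<Sum>i\<in>I. a i * c i x) = (\<lambda>x. \<Sum>i\<in>I. a i * up n (c i) x)"
proof
  fix x
  have "lin_fun (\<lambda>f. up n f x)"
    by (simp add: lin_fun_def up_lincomb)
  then show "up n (\<lambda>x. \<Sum>i\<in>I. a i * c i x) x = (\<Sum>i\<in>I. a i * up n (c i) x)"
    by (rule lin_fun_sum)
qed

lemma dn_sum: "dn n (\<lambda>x. \<Sum>i\<in>I. a i * c i x) = (\<lambda>x. \<Sum>i\<in>I. a i * dn n (c i) x)"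
proof
  fix x
  have "lin_fun (\<lambda>f. dn n f x)"
    by (simp add: lin_fun_def dn_lincomb)
  then show "dn n (\<lambda>x. \<Sum>i\<in>I. a i * c i x) x = (\<Sum>i\<in>I. a i * dn n (c i) x)"
    by (rule lin_fun_sum)
qed

lemma dn_up_eq:
  assumes "y \<in> X n"
  shows "dn n (up n f) y = (\<Sum>u\<in>X n. (\<Sum>x\<in>X (Suc n). e y x * e u x) * f u)"
proof -
  have "dn n (up n f) y = (\<Sum>x\<in>X (Suc n). \<Sum>u\<in>X n. e y x * e u x * f u)"
    using assms by (simp add: dn_def up_def sum_distrib_left mult.assoc)
  also have "\<dots> = (\<Sum>u\<in>X n. \<Sum>x\<in>X (Suc n). e y x * e u x * f u)"
    by (rule sum.swap)
  finally show ?thesis by (simp add: sum_distrib_right)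
qed

lemma sum_delta_weight:
  assumes "y \<in> X n"
  shows "(\<Sum>u\<in>X n. (if y = u then int R else 0) * f u) = int R * f y"
proof -
  have "(\<Sum>u\<in>X n. (if y = u then int R else 0) * f u) = (\<Sum>u\<in>X n. if y = u then int R * f u else 0)"
    by (rule sum.cong) auto
  then show ?thesis using assms finite_X by simp
qed

lemma dn_up_0:
  assumes "f \<in> V 0"
  shows "dn 0 (up 0 f) = (\<lambda>x. int R * f x)"
proof (rule V_eqI[of _ 0])
  show "(\<lambda>x. int R * f x) \<in> V 0" using assms by (auto simp: V_def)
  fix y assume y: "y \<in> X 0"
  have "dn 0 (up 0 f) y = (\<Sum>u\<in>X 0. (if y = u then int R else 0) * f u)"
    unfolding dn_up_eq[OF y] using y comm_0 by (intro sum.cong) auto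
  then show "dn 0 (up 0 f) y = int R * f y" using sum_delta_weight[OF y] by simp
qed (rule dn_V)

lemma dn_up_Suc:
  assumes "f \<in> V (Suc n)"
  shows "dn (Suc n) (up (Suc n) f) = (\<lambda>x. up n (dn n f) x + int R * f x)"
proof (rule V_eqI[of _ "Suc n"])
  show "(\<lambda>x. up n (dn n f) x + int R * f x) \<in> V (Suc n)"
    using assms by (auto simp: V_def up_def)
  fix y assume y: "y \<in> X (Suc n)"
  have "dn (Suc n) (up (Suc n) f) y
      = (\<Sum>u\<in>X (Suc n). ((\<Sum>z\<in>X n. e z y * e z u) + (if y = u then int R else 0)) * f u)"
    unfolding dn_up_eq[OF y] using y comm_Suc by (intro sum.cong) auto
  also have "\<dots> = (\<Sum>u\<in>X (Suc n). \<Sum>z\<in>X n. e z y * e z u * f u) + int R * f y"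
    by (simp only: distrib_right sum.distrib sum_delta_weight[OF y] sum_distrib_right)
  also have "(\<Sum>u\<in>X (Suc n). \<Sum>z\<in>X n. e z y * e z u * f u)
      = (\<Sum>z\<in>X n. \<Sum>u\<in>X (Suc n). e z y * e z u * f u)"
    by (rule sum.swap)
  also have "\<dots> = up n (dn n f) y"
    using y by (simp add: up_def dn_def sum_distrib_left mult.assoc)
  finally show "dn (Suc n) (up (Suc n) f) y = up n (dn n f) y + int R * f y" .
qed (rule dn_V)

section \<open>Systems of chains adapted to the up and down maps\<close>

lemma d_mono:
  assumes "i \<le> k"
  shows "d i \<le> d k"
proof (rule lift_Suc_mono_le[OF _ assms])
  show "d n \<le> d (Suc n)" for n using d_growth[of n] by linarith
qed

text \<open>\<open>lift b n i j\<close> is \<open>U\<^bsup>n-i\<^esup> (b i j)\<close>, meaningful for \<open>i \<le> n\<close> only.\<close>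

primrec lift :: "(nat \<Rightarrow> nat \<Rightarrow> 'v \<Rightarrow> int) \<Rightarrow> nat \<Rightarrow> nat \<Rightarrow> nat \<Rightarrow> 'v \<Rightarrow> int" where
  "lift b 0 i j = b 0 j"
| "lift b (Suc n) i j = (if i = Suc n then b (Suc n) j else up n (lift b n i j))"

lemma lift_self: "lift b n n j = b n j"
  by (cases n) auto

lemma lift_update: "i \<le> n \<Longrightarrow> lift (b(Suc n := c)) n i j = lift b n i j"
proof -
  have "m \<le> n \<Longrightarrow> lift (b(Suc n := c)) m i j = lift b m i j" for m i
    by (induction m) auto
  then show ?thesis by simp
qed

text \<open>The chain of \<open>j\<close> has a member in rank \<open>i\<close> exactly when
  \<open>j < d i\<close>. These pairs index the lifts to rank \<open>n\<close>; as the
  \<open>d i\<close> are differences of rank sizes, their number is the size of rank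
  \<open>n\<close>.\<close>

definition K :: "nat \<Rightarrow> (nat \<times> nat) set" where
  "K n = (SIGMA i:{..n}. {..<d i})"

lemma in_K: "(i, j) \<in> K n \<longleftrightarrow> i \<le> n \<and> j < d i"
  by (auto simp: K_def)

lemma finite_K: "finite (K n)"
  by (simp add: K_def)

lemma card_K: "card (K n) = card (X n)"
proof -
  have "card (K n) = (\<Sum>i\<le>n. d i)" by (simp add: K_def)
  also have "\<dots> = card (X n)" by (induction n) (auto simp: card_0 card_Suc)
  finally show ?thesis .
qed

text \<open>Spanning is demanded in rank \<open>n\<close> only, and independence follows by
  counting. As \<open>d\<close> is nondecreasing, each \<open>j\<close> belongs to one unbroken
  chain from its first rank up to \<open>n\<close>.\<close>

definition adapted :: "(nat \<Rightarrow> nat \<Rightarrow> 'v \<Rightarrow> int) \<Rightarrow> nat \<Rightarrow> bool" where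
  "adapted b n \<longleftrightarrow> (\<forall>i\<le>n. \<forall>j<d i. b i j \<in> V i) \<and>
     (\<forall>i<n. \<forall>j<d (Suc i). dn i (b (Suc i) j) = (if j < d i then b i j else (\<lambda>x. 0))) \<and>
     V n \<subseteq> lspan (K n) (\<lambda>(i, j). lift b n i j)"

lemma adapted_V: "adapted b n \<Longrightarrow> i \<le> n \<Longrightarrow> j < d i \<Longrightarrow> b i j \<in> V i"
  by (auto simp: adapted_def)

lemma adapted_dn:
  "adapted b n \<Longrightarrow> i < n \<Longrightarrow> j < d (Suc i) \<Longrightarrow> dn i (b (Suc i) j) = (if j < d i then b i j else (\<lambda>x. 0))"
  by (simp add: adapted_def)

lemma adapted_span:
  assumes "adapted b n" "v \<in> V n"
  obtains \<alpha> where "v = (\<lambda>x. \<Sum>(i, j)\<in>K n. \<alpha> i j * lift b n i j x)"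
proof -
  from assms have "v \<in> lspan (K n) (\<lambda>(i, j). lift b n i j)" by (auto simp: adapted_def)
  then obtain a where "v = (\<lambda>x. \<Sum>k\<in>K n. a k * (case k of (i, j) \<Rightarrow> lift b n i j) x)"
    by (rule lspanE)
  then have "v = (\<lambda>x. \<Sum>(i, j)\<in>K n. curry a i j * lift b n i j x)"
    by (simp add: case_prod_unfold)
  then show ?thesis by (rule that)
qed

lemma lift_V:
  assumes "i \<le> n" "b i j \<in> V i"
  shows "lift b n i j \<in> V n"
  using assms by (cases n) (auto simp: up_V)

definition wt :: "nat \<Rightarrow> nat \<Rightarrow> int" where
  "wt n i = int ((n - i + 1) * R)"

text \<open>By induction from \<open>(DU) U = U (DU) + R U\<close>: each application of
  \<open>U\<close> adds \<open>R\<close> to the weight. The hypotheses are the two parts of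
  \<open>adapted\<close> that pass to lower ranks, as the induction on \<open>n\<close>
  demands.\<close>

lemma dn_up_lift:
  assumes V: "\<And>i j. i \<le> n \<Longrightarrow> j < d i \<Longrightarrow> b i j \<in> V i"
    and dn: "\<And>i j. i < n \<Longrightarrow> j < d (Suc i) \<Longrightarrow> dn i (b (Suc i) j) = (if j < d i then b i j else (\<lambda>x. 0))"
    and "i \<le> n" "j < d i"
  shows "dn n (up n (lift b n i j)) =
    (\<lambda>x. wt n i * lift b n i j x + (if 0 < i \<and> j < d (i - 1) then lift b n (i - 1) j x else 0))"
  using assms
proof (induction n)
  case 0
  then show ?case by (simp add: dn_up_0 wt_def)
next
  case (Suc n)
  have inV: "lift b (Suc n) i j \<in> V (Suc n)"
    using Suc.prems by (intro lift_V) auto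
  show ?case
  proof (cases "i = Suc n")
    case True
    have "up n (dn n (b (Suc n) j)) = (\<lambda>x. if j < d n then up n (b n j) x else 0)"
      using Suc.prems True by (auto simp: up_def)
    then show ?thesis
      using True inV by (auto simp: dn_up_Suc wt_def lift_self algebra_simps)
  next
    case False
    with Suc.prems have i: "i \<le> n" by simp
    define h where "h = (\<lambda>x. if 0 < i \<and> j < d (i - 1) then lift b n (i - 1) j x else 0)"
    have "dn n (up n (lift b n i j)) = (\<lambda>x. wt n i * lift b n i j x + 1 * h x)"
      using Suc i by (simp add: h_def)
    then have "up n (dn n (up n (lift b n i j))) = (\<lambda>x. wt n i * up n (lift b n i j) x + up n h x)"
      by (simp only: up_lincomb) simp
    moreover have "up n h = (\<lambda>x. if 0 < i \<and> j < d (i - 1) then up n (lift b n (i - 1) j) x else 0)"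
      by (auto simp: h_def up_def)
    ultimately show ?thesis
      using False i inV
      by (cases "0 < i \<and> j < d (i - 1)") (auto simp: dn_up_Suc wt_def Suc_diff_le algebra_simps)
  qed
qed

lemma adapted_dn_up_lift:
  assumes "adapted b n" "i \<le> n" "j < d i"
  shows "dn n (up n (lift b n i j)) =
    (\<lambda>x. wt n i * lift b n i j x + (if 0 < i \<and> j < d (i - 1) then lift b n (i - 1) j x else 0))"
  using assms by (intro dn_up_lift) (auto simp: adapted_def)

text \<open>Preimages of the point masses under \<open>D\<close> act, by transposition, as
  functionals that read \<open>u\<close> off from \<open>U u\<close>. In a basis of rank
  \<open>Suc m\<close> dual to them, \<open>card (X m)\<close> members match the functionals; the
  others span their common kernel, which is complementary to the image of \<open>U\<close>.\<close>

lemma ex_up_complement: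
  "\<exists>c. (\<forall>k<d (Suc m). c k \<in> V (Suc m)) \<and>
     (\<forall>v\<in>V (Suc m). \<exists>u\<in>V m. \<exists>a. v = (\<lambda>x. up m u x + (\<Sum>k<d (Suc m). a k * c k x)))"
proof -
  have "\<forall>y. \<exists>f. \<forall>y'\<in>X m. (\<Sum>x\<in>X (Suc m). e y' x * f x) = (if y' = y then 1 else 0)"
    by (intro allI down_surj)
  from choice[OF this] obtain F where
    F: "\<And>y y'. y' \<in> X m \<Longrightarrow> (\<Sum>x\<in>X (Suc m). e y' x * F y x) = (if y' = y then 1 else 0)"
    by blast
  define p where "p = card (X m)"
  define q where "q = card (X (Suc m))"
  have q: "q = p + d (Suc m)" by (simp add: p_def q_def card_Suc)
  obtain hy where hy: "bij_betw hy {..<p} (X m)"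
    using ex_bij_betw_nat_finite[OF finite_X] by (auto simp: p_def lessThan_atLeast0)
  obtain hx where hx: "bij_betw hx {..<q} (X (Suc m))"
    using ex_bij_betw_nat_finite[OF finite_X] by (auto simp: q_def lessThan_atLeast0)
  define \<phi> where "\<phi> = (\<lambda>j v. \<Sum>x\<in>X (Suc m). F (hy j) x * v x)"
  have lin: "lin_fun (\<phi> j)" for j
    unfolding \<phi>_def by (rule lin_fun_weighted_sum)
  have \<phi>_up: "\<phi> j (up m u) = u (hy j)" if "j < p" for j u
  proof -
    have hj: "hy j \<in> X m" using hy that by (auto simp: bij_betw_def)
    have "\<phi> j (up m u) = (\<Sum>x\<in>X (Suc m). \<Sum>y\<in>X m. u y * (e y x * F (hy j) x))"
      unfolding \<phi>_def up_def by (simp add: sum_distrib_left algebra_simps)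
    also have "\<dots> = (\<Sum>y\<in>X m. \<Sum>x\<in>X (Suc m). u y * (e y x * F (hy j) x))"
      by (rule sum.swap)
    also have "\<dots> = (\<Sum>y\<in>X m. if y = hy j then u y else 0)"
      by (rule sum.cong) (simp_all add: sum_distrib_left[symmetric] F)
    also have "\<dots> = u (hy j)" using hj finite_X by simp
    finally show ?thesis .
  qed
  define \<delta> where "\<delta> = (\<lambda>k x. if x = hx k then 1 else 0 :: int)"
  have \<delta>: "lspan {..<q} \<delta> = V (Suc m)"
  proof
    show "lspan {..<q} \<delta> \<subseteq> V (Suc m)"
      using hx by (intro V_lspan) (auto simp: \<delta>_def bij_betw_def intro!: delta_V)
    show "V (Suc m) \<subseteq> lspan {..<q} \<delta>"
    proof
      fix v assume v: "v \<in> V (Suc m)"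
      have "(\<Sum>k<q. v (hx k) * \<delta> k x) = v x" for x
      proof -
        have "(\<Sum>k<q. v (hx k) * \<delta> k x) = (\<Sum>x'\<in>X (Suc m). v x' * (if x = x' then 1 else 0))"
          unfolding \<delta>_def by (rule sum.reindex_bij_betw[OF hx])
        also have "\<dots> = (\<Sum>x'\<in>X (Suc m). if x = x' then v x' else 0)"
          by (rule sum.cong) auto
        also have "\<dots> = v x" using v finite_X by (auto simp: V_def)
        finally show ?thesis .
      qed
      then show "v \<in> lspan {..<q} \<delta>" by (intro lspanI[where a = "\<lambda>k. v (hx k)"]) simp
    qed
  qed
  \<comment> \<open>Modulus 0 means equality. The images under \<open>U\<close> of the point masses
    have the wanted values, so the standard basis can be made dual to the functionals.\<close>
  have "\<exists>c'. lspan {..<q} c' = lspan {..<q} \<delta> \<and> (\<forall>k<q. \<forall>j<p. 0 dvd \<phi> j (c' k) - (if j = k then 1 else 0))"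
  proof (rule ex_lspan_dual_mod[where y = "\<lambda>_. 0"])
    show "p < q \<or> p \<le> q \<and> (\<forall>j<p. (0::int) = 0 \<or> (0::int) = 2)" by (simp add: q)
    fix i assume i: "i < p"
    have "\<phi> j (up m (\<lambda>y. if y = hy i then 1 else 0)) = (if j = i then 1 else 0)" if "j < p" for j
      using \<phi>_up[OF that] hy i that by (auto simp: bij_betw_def inj_on_def)
    then show "\<exists>v\<in>lspan {..<q} \<delta>. \<forall>j<p. 0 dvd \<phi> j v - (if j = i then 1 else 0)"
      unfolding \<delta> by (intro bexI[of _ "up m (\<lambda>y. if y = hy i then 1 else 0)"]) (auto simp: up_V)
  qed (auto intro: lin)
  then obtain c' where c': "lspan {..<q} c' = V (Suc m)"
    and \<phi>c': "\<And>k j. k < q \<Longrightarrow> j < p \<Longrightarrow> \<phi> j (c' k) = (if j = k then 1 else 0)"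
    unfolding \<delta> by auto
  have split: "(\<Sum>k<p + D. f k) = (\<Sum>k<p. f k) + (\<Sum>k<D. f (p + k))" for f :: "nat \<Rightarrow> int" and D
    by (induction D) auto
  have c'V: "c' k \<in> V (Suc m)" if "k < q" for k
    using lspan_base[of "{..<q}" k c'] that c' by auto
  have "\<exists>u\<in>V m. \<exists>a. v = (\<lambda>x. up m u x + (\<Sum>k<d (Suc m). a k * c' (p + k) x))"
    if v: "v \<in> V (Suc m)" for v
  proof -
    \<comment> \<open>\<open>u\<close> collects the values of the functionals on \<open>v\<close>;
      hence they all vanish on \<open>w\<close>, and only members from index \<open>p\<close> on
      occur in it.\<close>
    define u where "u = (\<lambda>y. if y \<in> X m then \<Sum>x\<in>X (Suc m). F y x * v x else 0)"
    define w where "w = (\<lambda>x. 1 * v x + (-1) * up m u x)"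
    have "w \<in> V (Suc m)" unfolding w_def by (intro V_lincomb v up_V)
    then obtain a where a: "w = (\<lambda>x. \<Sum>k<q. a k * c' k x)"
      unfolding c'[symmetric] by (rule lspanE)
    have "a j = 0" if j: "j < p" for j
    proof -
      have "\<phi> j w = \<phi> j v - u (hy j)"
        unfolding w_def lin_funD[OF lin] \<phi>_up[OF j] by simp
      also have "\<dots> = 0"
        using hy j by (auto simp: u_def \<phi>_def bij_betw_def)
      finally have "\<phi> j w = 0" .
      moreover have "\<phi> j w = (\<Sum>k<q. if j = k then a k else 0)"
        unfolding a lin_fun_sum[OF lin] using \<phi>c' j by (intro sum.cong) auto
      ultimately show ?thesis using j q by simp
    qed
    then have "w x = (\<Sum>k<d (Suc m). a (p + k) * c' (p + k) x)" for x
      unfolding a q split by simp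
    then have "v = (\<lambda>x. up m u x + (\<Sum>k<d (Suc m). a (p + k) * c' (p + k) x))"
      by (simp add: w_def fun_eq_iff algebra_simps)
    moreover have "u \<in> V m" by (auto simp: u_def V_def)
    ultimately show ?thesis by (intro bexI[of _ u] exI[of _ "\<lambda>k. a (p + k)"])
  qed
  then show ?thesis
    using c'V q by (intro exI[of _ "\<lambda>k. c' (p + k)"]) auto
qed

section \<open>The image of \<open>DU\<close> and the tops of the chains\<close>

lemma ex_dn_up_shift_in_lspan:
  assumes ad: "adapted b m" and g: "g \<in> V m"
  shows "\<exists>u\<in>V m. (\<lambda>x. g x + dn m (up m u) x) \<in> lspan {..<d m} (b m)"
proof -
  \<comment> \<open>\<open>DU\<close> sends the lift of level \<open>Suc k\<close> to a multiple of
    itself plus the lift of level \<open>k\<close>. So modulo the image of \<open>DU\<close> each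
    lift is a multiple of the next one in its chain, and finally of \<open>b m j\<close>.\<close>
  have base: "\<exists>u\<in>V m. (\<lambda>x. lift b m i j x + dn m (up m u) x) \<in> lspan {..<d m} (b m)"
    if "i \<le> m" and j: "j < d i" for i j
    using that(1)
  proof (induction rule: inc_induct)
    case base
    have "(\<lambda>x. lift b m m j x + dn m (up m (\<lambda>x. 0)) x) = b m j"
      by (simp add: lift_self up_def dn_def fun_eq_iff)
    moreover have "j < d m" using d_mono[OF that(1)] j by simp
    ultimately show ?case
      by (intro bexI[of _ "\<lambda>x. 0"]) (auto simp: V_def intro: lspan_base)
  next
    case (step k)
    then obtain u where u: "u \<in> V m"
      and sp: "(\<lambda>x. lift b m (Suc k) j x + dn m (up m u) x) \<in> lspan {..<d m} (b m)" by auto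
    have jk: "j < d k" "j < d (Suc k)"
      using d_mono[of i k] d_mono[of i "Suc k"] step.hyps j by auto
    let ?w = "wt m (Suc k)"
    \<comment> \<open>The first term removes \<open>lift b m k j\<close>; the second carries along
      the correction \<open>u\<close> already known for level \<open>Suc k\<close>.\<close>
    define u' where "u' = (\<lambda>x. (-1) * lift b m (Suc k) j x + (- ?w) * u x)"
    have "lift b m (Suc k) j \<in> V m"
      using step.hyps jk adapted_V[OF ad] by (intro lift_V) auto
    then have "u' \<in> V m" unfolding u'_def by (intro V_lincomb u)
    have eq: "dn m (up m u') = (\<lambda>x. (-1) * (?w * lift b m (Suc k) j x + lift b m k j x) + (- ?w) * dn m (up m u) x)"
      unfolding u'_def up_lincomb dn_lincomb using adapted_dn_up_lift[OF ad, of "Suc k" j] step.hyps jk by simp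
    have "(\<lambda>x. lift b m k j x + dn m (up m u') x)
        = (\<lambda>x. (- ?w) * (lift b m (Suc k) j x + dn m (up m u) x) + 0 * (lift b m (Suc k) j x + dn m (up m u) x))"
      unfolding eq by (simp add: algebra_simps)
    also have "\<dots> \<in> lspan {..<d m} (b m)"
      by (rule lspan_lincomb[OF sp sp])
    finally show ?case using \<open>u' \<in> V m\<close> by blast
  qed
  obtain \<alpha> where \<alpha>: "g = (\<lambda>x. \<Sum>(i, j)\<in>K m. \<alpha> i j * lift b m i j x)"
    using adapted_span[OF ad g] .
  have "\<forall>k\<in>K m. \<exists>u. u \<in> V m \<and>
      (\<lambda>x. lift b m (fst k) (snd k) x + dn m (up m u) x) \<in> lspan {..<d m} (b m)"
    using base unfolding Bex_def by (auto simp: in_K)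
  from bchoice[OF this] obtain w where wV: "\<And>k. k \<in> K m \<Longrightarrow> w k \<in> V m"
    and w: "\<And>k. k \<in> K m \<Longrightarrow> (\<lambda>x. lift b m (fst k) (snd k) x + dn m (up m (w k)) x) \<in> lspan {..<d m} (b m)"
    by blast
  define u where "u = (\<lambda>x. \<Sum>k\<in>K m. \<alpha> (fst k) (snd k) * w k x)"
  have "(\<lambda>x. g x + dn m (up m u) x)
      = (\<lambda>x. \<Sum>k\<in>K m. \<alpha> (fst k) (snd k) * (lift b m (fst k) (snd k) x + dn m (up m (w k)) x))"
    unfolding \<alpha> u_def up_sum dn_sum
    by (simp add: case_prod_unfold sum.distrib[symmetric] distrib_left)
  also have "\<dots> \<in> lspan {..<d m} (b m)"
    by (rule lspan_sum[OF w])
  finally show ?thesis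
    using wV by (intro bexI[of _ u]) (auto simp: u_def intro: V_sum)
qed

text \<open>
  Solving \<open>DU u = \<beta> b m j\<close> along the chain of \<open>j\<close> forces the coefficients of \<open>u\<close> to satisfy
  \<open>\<alpha> (k + 1) = - wt m k * \<alpha> k\<close> and \<open>\<beta> = wt m m * \<alpha> m\<close>. Hence the admissible \<open>\<beta>\<close> are the multiples of
  \<open>modulus m j\<close>, which is the value of \<open>\<beta>\<close> for \<open>\<alpha> (chain_start j) = 1\<close>.
\<close>

definition chain_start :: "nat \<Rightarrow> nat" where
  "chain_start j = (LEAST i. j < d i)"

text \<open>\<open>d\<close> is nondecreasing, so once a chain has begun it has a member in every
  later rank; the assumption guarantees that it begins at all.\<close>

lemma chain_start_le_iff:
  assumes "j < d m"
  shows "chain_start j \<le> k \<longleftrightarrow> j < d k"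
  using LeastI[of "\<lambda>i. j < d i" m] assms d_mono[of "chain_start j" k]
  by (auto simp: chain_start_def intro: Least_le)

definition chain_coeff :: "nat \<Rightarrow> nat \<Rightarrow> nat \<Rightarrow> int" where
  "chain_coeff m i k = (\<Prod>l=i..<k. - wt m l)"

lemma chain_coeff_Suc: "i \<le> k \<Longrightarrow> chain_coeff m i (Suc k) = - chain_coeff m i k * wt m k"
  by (simp add: chain_coeff_def prod.atLeastLessThan_Suc)

definition modulus :: "nat \<Rightarrow> nat \<Rightarrow> int" where
  "modulus m j = chain_coeff m (chain_start j) m * wt m m"

text \<open>The chain of a larger index starts no earlier, so its modulus is a product over a subset
  of the factors.\<close>

lemma modulus_dvd:
  assumes "Suc j < d m"
  shows "modulus m (Suc j) dvd modulus m j"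
proof -
  have "j < d (chain_start (Suc j))"
    using chain_start_le_iff[OF assms, of "chain_start (Suc j)"] by simp
  then have "chain_start j \<le> chain_start (Suc j)"
    by (simp add: chain_start_def Least_le)
  then show ?thesis
    unfolding modulus_def chain_coeff_def
    by (intro mult_dvd_mono prod_dvd_prod_subset) auto
qed

text \<open>The coefficients \<open>chain_coeff\<close> obey the recurrence under which
  \<open>chain_sum\<close> telescopes to the top of the chain.\<close>

lemma ex_dn_up_eq_modulus:
  assumes ad: "adapted b m" and j: "j < d m"
  shows "\<exists>u\<in>V m. dn m (up m u) = (\<lambda>x. modulus m j * b m j x)"
proof -
  let ?i = "chain_start j"
  define u where "u = (\<lambda>x. \<Sum>k\<in>{?i..m}. chain_coeff m ?i k * lift b m k j x)"
  have im: "?i \<le> m" using chain_start_le_iff[OF j] j by simp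
  have jk: "j < d k" if "?i \<le> k" for k
    using chain_start_le_iff[OF j] that by simp
  have "u \<in> V m"
    unfolding u_def using jk adapted_V[OF ad] by (intro V_sum lift_V) auto
  moreover have "dn m (up m u) = (\<lambda>x. modulus m j * b m j x)"
  proof
    fix x
    have "dn m (up m u) x = (\<Sum>k=?i..m. chain_coeff m ?i k * dn m (up m (lift b m k j)) x)"
      unfolding u_def up_sum dn_sum ..
    also have "\<dots> = (\<Sum>k=?i..m. chain_coeff m ?i k *
        (wt m k * lift b m k j x + (if ?i < k then lift b m (k - 1) j x else 0)))"
    proof (rule sum.cong)
      fix k assume k: "k \<in> {?i..m}"
      \<comment> \<open>A preceding member exists exactly above the start of the chain.\<close>
      have "(0 < k \<and> j < d (k - 1)) = (?i < k)"
        using chain_start_le_iff[OF j, of "k - 1"] chain_start_le_iff[OF j, of k] jk[of k] k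
        by (cases k) auto
      then show "chain_coeff m ?i k * dn m (up m (lift b m k j)) x = chain_coeff m ?i k *
        (wt m k * lift b m k j x + (if ?i < k then lift b m (k - 1) j x else 0))"
        using adapted_dn_up_lift[OF ad, of k j] jk k by auto
    qed simp
    also have "\<dots> = chain_coeff m ?i m * wt m m * lift b m m j x"
      using chain_coeff_Suc by (intro chain_sum[OF im]) auto
    finally show "dn m (up m u) x = modulus m j * b m j x"
      by (simp add: modulus_def lift_self)
  qed
  ultimately show ?thesis by blast
qed

lemma adapted_independent:
  assumes ad: "adapted b m" and zero: "\<And>x. (\<Sum>(i, j)\<in>K m. cf i j * lift b m i j x) = 0"
    and "i \<le> m" "j < d i"
  shows "cf i j = 0"
proof -
  have "(\<lambda>(i, j). cf i j) (i, j) = 0"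
  proof (rule spanning_family_independent[OF finite_X finite_K card_K])
    show "(i, j) \<in> K m" using assms by (simp add: in_K)
    show "(\<Sum>k\<in>K m. (\<lambda>(i, j). cf i j) k * (\<lambda>(i, j). lift b m i j) k x) = 0" for x
      using zero[of x] by (simp add: case_prod_unfold)
    show "(\<lambda>x'. if x' = x then 1 else 0) \<in> lspan (K m) (\<lambda>(i, j). lift b m i j)" if "x \<in> X m" for x
      using ad delta_V[OF that] by (auto simp: adapted_def)
  qed
  then show ?thesis by simp
qed

text \<open>Comparing coefficients in the basis of lifts gives a recurrence for the coefficients of
  \<open>u\<close> along a chain, which carries divisibility from its start to its top.\<close>

lemma modulus_dvd_coeff:
  assumes ad: "adapted b m" and u: "u \<in> V m"
    and eq: "dn m (up m u) = (\<lambda>x. \<Sum>j<d m. \<beta> j * b m j x)" and j: "j < d m"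
  shows "modulus m j dvd \<beta> j"
proof -
  obtain \<alpha> where \<alpha>: "u = (\<lambda>x. \<Sum>(i, j)\<in>K m. \<alpha> i j * lift b m i j x)"
    using adapted_span[OF ad u] .
  \<comment> \<open>The coefficient of \<open>lift b m i j\<close> in \<open>DU u\<close> minus the
    given right-hand side; the term with \<open>Suc i\<close> comes from the next member of the
    chain, whose image contains this one.\<close>
  define cf where "cf = (\<lambda>i j. \<alpha> i j * wt m i + (if i < m then \<alpha> (Suc i) j else 0) - (if i = m then \<beta> j else 0))"
  have "(\<Sum>(i, j)\<in>K m. cf i j * lift b m i j x) = 0" for x
  proof -
    let ?L = "\<lambda>i j. lift b m i j x"
    have "dn m (up m u) x = (\<Sum>(i, j)\<in>K m. \<alpha> i j * dn m (up m (lift b m i j)) x)"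
      unfolding \<alpha> case_prod_unfold up_sum dn_sum ..
    also have "\<dots> = (\<Sum>(i, j)\<in>K m. \<alpha> i j * wt m i * ?L i j
        + \<alpha> i j * (if 0 < i \<and> j < d (i - 1) then ?L (i - 1) j else 0))"
      by (rule sum.cong) (auto simp: adapted_dn_up_lift[OF ad] in_K distrib_left)
    also have "\<dots> = (\<Sum>i\<le>m. \<Sum>j<d i. \<alpha> i j * wt m i * ?L i j)
        + (\<Sum>i\<le>m. \<Sum>j<d i. \<alpha> i j * (if 0 < i \<and> j < d (i - 1) then ?L (i - 1) j else 0))"
      by (simp add: K_def sum.Sigma[symmetric] sum.distrib)
    also have "(\<Sum>i\<le>m. \<Sum>j<d i. \<alpha> i j * (if 0 < i \<and> j < d (i - 1) then ?L (i - 1) j else 0))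
        = (\<Sum>i\<le>m. \<Sum>j<d i. (if i < m then \<alpha> (Suc i) j else 0) * ?L i j)"
    proof (cases m)
      case 0
      then show ?thesis by simp
    next
      case (Suc m')
      \<comment> \<open>An index \<open>j \<ge> d i\<close> starts a new chain in rank
        \<open>Suc i\<close>, so it contributes nothing to level \<open>i\<close>.\<close>
      have "(\<Sum>j<d (Suc i). \<alpha> (Suc i) j * (if j < d i then lift b m i j x else 0))
          = (\<Sum>j<d i. \<alpha> (Suc i) j * lift b m i j x)" for i
        using d_mono[of i "Suc i"] by (intro sum.mono_neutral_cong_right) auto
      then have "(\<Sum>i\<le>Suc m'. \<Sum>j<d i. \<alpha> i j * (if 0 < i \<and> j < d (i - 1) then ?L (i - 1) j else 0))
          = (\<Sum>i\<le>m'. \<Sum>j<d i. \<alpha> (Suc i) j * ?L i j)"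
        by (simp add: sum.atMost_Suc_shift del: sum.atMost_Suc cong: if_cong)
      also have "\<dots> = (\<Sum>i\<le>Suc m'. \<Sum>j<d i. (if i < Suc m' then \<alpha> (Suc i) j else 0) * ?L i j)"
        by simp
      finally show ?thesis by (simp only: Suc)
    qed
    finally have "dn m (up m u) x = (\<Sum>i\<le>m. \<Sum>j<d i. \<alpha> i j * wt m i * ?L i j)
      + (\<Sum>i\<le>m. \<Sum>j<d i. (if i < m then \<alpha> (Suc i) j else 0) * ?L i j)" .
    moreover have "(\<Sum>i\<le>m. \<Sum>j<d i. (if i = m then \<beta> j else 0) * ?L i j)
        = (\<Sum>i\<le>m. if i = m then \<Sum>j<d i. \<beta> j * ?L i j else 0)"
      by (rule sum.cong) auto
    then have "(\<Sum>i\<le>m. \<Sum>j<d i. (if i = m then \<beta> j else 0) * ?L i j) = (\<Sum>j<d m. \<beta> j * b m j x)"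
      by (simp add: lift_self)
    ultimately show ?thesis
      using fun_cong[OF eq, of x]
      by (simp add: cf_def K_def sum.Sigma[symmetric] sum.distrib sum_subtractf algebra_simps)
  qed
  note cf0 = adapted_independent[OF ad this]
  let ?i = "chain_start j"
  have im: "?i \<le> m" using chain_start_le_iff[OF j] j by simp
  have "k \<le> m \<Longrightarrow> chain_coeff m ?i k dvd \<alpha> k j" if "?i \<le> k" for k
    using that
  proof (induction k rule: dec_induct)
    case base
    show ?case by (simp add: chain_coeff_def)
  next
    case (step k)
    have "j < d k" using chain_start_le_iff[OF j, of k] step by simp
    then have "\<alpha> (Suc k) j = - (\<alpha> k j * wt m k)"
      using cf0[of k j] step by (simp add: cf_def)
    then show ?case using step by (simp add: chain_coeff_Suc)
  qed
  then have "chain_coeff m ?i m dvd \<alpha> m j" using im by simp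
  moreover have "\<beta> j = \<alpha> m j * wt m m" using cf0[of m j] j by (simp add: cf_def)
  ultimately show ?thesis by (simp add: modulus_def)
qed

lemma dn_surj:
  assumes "g \<in> V m"
  shows "\<exists>w\<in>V (Suc m). dn m w = g"
proof -
  obtain f where f: "\<And>y. y \<in> X m \<Longrightarrow> (\<Sum>x\<in>X (Suc m). e y x * f x) = g y"
    using down_surj[of m g] by blast
  define w where "w = (\<lambda>x. if x \<in> X (Suc m) then f x else 0)"
  have "dn m w = g"
    by (rule V_eqI[OF dn_V assms]) (simp add: dn_def w_def f)
  then show ?thesis by (intro bexI[of _ w]) (auto simp: w_def V_def)
qed

section \<open>Extending an adapted system by one rank\<close>

definition complements :: "nat \<Rightarrow> (nat \<Rightarrow> 'v \<Rightarrow> int) \<Rightarrow> bool" where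
  "complements m c \<longleftrightarrow> (\<forall>k<d (Suc m). c k \<in> V (Suc m)) \<and>
     (\<forall>v\<in>V (Suc m). \<exists>u\<in>V m. \<exists>a. v = (\<lambda>x. up m u x + (\<Sum>k<d (Suc m). a k * c k x)))"

text \<open>What is added lies in the image of \<open>U\<close> and is absorbed by the summand
  \<open>up m u\<close>.\<close>

lemma complements_shift:
  assumes c: "complements m c" and w: "\<And>k. k < d (Suc m) \<Longrightarrow> w k \<in> V m"
  shows "complements m (\<lambda>k x. 1 * c k x + 1 * up m (w k) x)"
  unfolding complements_def
proof (intro conjI allI impI ballI)
  show "(\<lambda>x. 1 * c k x + 1 * up m (w k) x) \<in> V (Suc m)" if "k < d (Suc m)" for k
    using c that unfolding complements_def by (intro V_lincomb up_V) auto
  fix v assume "v \<in> V (Suc m)"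
  then obtain u a where u: "u \<in> V m" and v: "v = (\<lambda>x. up m u x + (\<Sum>k<d (Suc m). a k * c k x))"
    using c unfolding complements_def by blast
  define u' where "u' = (\<lambda>x. 1 * u x + (-1) * (\<Sum>k<d (Suc m). a k * w k x))"
  have "u' \<in> V m" unfolding u'_def by (intro V_lincomb u V_sum w) auto
  moreover have "up m u' = (\<lambda>x. 1 * up m u x + (-1) * (\<Sum>k<d (Suc m). a k * up m (w k) x))"
    unfolding u'_def up_lincomb up_sum ..
  then have "v = (\<lambda>x. up m u' x + (\<Sum>k<d (Suc m). a k * (1 * c k x + 1 * up m (w k) x)))"
    unfolding v by (simp add: fun_eq_iff distrib_left sum.distrib)
  ultimately show "\<exists>u\<in>V m. \<exists>a. v = (\<lambda>x. up m u x + (\<Sum>k<d (Suc m). a k * (1 * c k x + 1 * up m (w k) x)))"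
    by blast
qed

lemma complements_change:
  assumes c: "complements m c" and c'V: "\<And>k. k < d (Suc m) \<Longrightarrow> c' k \<in> V (Suc m)"
    and sp: "\<And>k. k < d (Suc m) \<Longrightarrow> c k \<in> lspan {..<d (Suc m)} c'"
  shows "complements m c'"
  unfolding complements_def
proof (intro conjI allI impI ballI c'V)
  fix v assume "v \<in> V (Suc m)"
  then obtain u a where u: "u \<in> V m" and v: "v = (\<lambda>x. up m u x + (\<Sum>k<d (Suc m). a k * c k x))"
    using c unfolding complements_def by blast
  have "(\<lambda>x. \<Sum>k<d (Suc m). a k * c k x) \<in> lspan {..<d (Suc m)} c'"
    using sp by (intro lspan_sum) auto
  then obtain a' where "(\<lambda>x. \<Sum>k<d (Suc m). a k * c k x) = (\<lambda>x. \<Sum>k<d (Suc m). a' k * c' k x)"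
    by (rule lspanE)
  then have "v = (\<lambda>x. up m u x + (\<Sum>k<d (Suc m). a' k * c' k x))"
    unfolding v by (auto simp: fun_eq_iff)
  then show "\<exists>u\<in>V m. \<exists>a. v = (\<lambda>x. up m u x + (\<Sum>k<d (Suc m). a k * c' k x))"
    using u by blast
qed

text \<open>A complement is corrected three times: by a shift along the image of \<open>U\<close>,
  so that \<open>D\<close> lands in the span of the \<open>b m j\<close>; by a unimodular change, so
  that the coordinates are right modulo the moduli; and by a second shift that makes them
  exact.\<close>

lemma adapted_step:
  assumes ad: "adapted b m"
  shows "\<exists>c. adapted (b(Suc m := c)) (Suc m)"
proof -
  let ?D = "d (Suc m)"
  obtain c0 where c0: "complements m c0"
    using ex_up_complement[of m] unfolding complements_def by blast
  have "\<forall>k. \<exists>u. u \<in> V m \<and> (\<lambda>x. dn m (c0 k) x + dn m (up m u) x) \<in> lspan {..<d m} (b m)"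
    using ex_dn_up_shift_in_lspan[OF ad dn_V] by blast
  from choice[OF this] obtain u0 where u0V: "\<And>k. u0 k \<in> V m"
    and u0: "\<And>k. (\<lambda>x. dn m (c0 k) x + dn m (up m (u0 k)) x) \<in> lspan {..<d m} (b m)"
    by blast
  define c1 where "c1 = (\<lambda>k x. 1 * c0 k x + 1 * up m (u0 k) x)"
  have c1: "complements m c1"
    unfolding c1_def using c0 u0V by (rule complements_shift)
  have "\<exists>f. dn m (c1 k) = (\<lambda>x. \<Sum>j<d m. f j * b m j x)" for k
    using u0[of k] unfolding c1_def dn_lincomb by (auto elim: lspanE)
  then have "\<forall>k. \<exists>f. dn m (c1 k) = (\<lambda>x. \<Sum>j<d m. f j * b m j x)" by blast
  from choice[OF this] obtain \<Phi> where \<Phi>: "\<And>k. dn m (c1 k) = (\<lambda>x. \<Sum>j<d m. \<Phi> k j * b m j x)"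
    by blast
  have dn_comb: "dn m (\<lambda>x. \<Sum>k<?D. a k * c1 k x) = (\<lambda>x. \<Sum>j<d m. (\<Sum>k<?D. \<Phi> k j * a k) * b m j x)" for a
  proof
    fix x
    have "dn m (\<lambda>x. \<Sum>k<?D. a k * c1 k x) x = (\<Sum>k<?D. \<Sum>j<d m. a k * (\<Phi> k j * b m j x))"
      unfolding dn_sum \<Phi> by (simp add: sum_distrib_left)
    also have "\<dots> = (\<Sum>j<d m. \<Sum>k<?D. a k * (\<Phi> k j * b m j x))"
      by (rule sum.swap)
    finally show "dn m (\<lambda>x. \<Sum>k<?D. a k * c1 k x) x = (\<Sum>j<d m. (\<Sum>k<?D. \<Phi> k j * a k) * b m j x)"
      by (simp add: sum_distrib_right sum_distrib_left mult_ac)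
  qed
  \<comment> \<open>For a coefficient vector \<open>v\<close> this is the \<open>j\<close>-th
    coordinate of \<open>D\<close> on the combination of the \<open>c1 l\<close>; the column
    operations act on these vectors.\<close>
  define \<phi> where "\<phi> = (\<lambda>j v. \<Sum>l<?D. \<Phi> l j * (v l :: int))"
  define \<delta> where "\<delta> = (\<lambda>k l :: nat. if l = k then 1 else 0 :: int)"
  have \<delta>_sum: "(\<Sum>k<?D. a k * \<delta> k l) = a l" if "l < ?D" for a l
  proof -
    have "(\<Sum>k<?D. a k * \<delta> k l) = (\<Sum>k<?D. if l = k then a k else 0)"
      by (rule sum.cong) (auto simp: \<delta>_def)
    then show ?thesis using that by simp
  qed
  have "\<exists>A. lspan {..<?D} A = lspan {..<?D} \<delta> \<and>
      (\<forall>k<?D. \<forall>j<d m. modulus m j dvd \<phi> j (A k) - (if j = k then 1 else 0))"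
  proof (rule ex_lspan_dual_mod)
    show "lin_fun (\<phi> j)" for j unfolding \<phi>_def by (rule lin_fun_weighted_sum)
    \<comment> \<open>In the exceptional case \<open>m = 0\<close> and \<open>R = 2\<close>, the
      modulus is an empty product times \<open>wt 0 0 = 2\<close>.\<close>
    show "d m < ?D \<or> d m \<le> ?D \<and> (\<forall>j<d m. modulus m j = 0 \<or> modulus m j = 2)"
      using d_growth[of m] by (auto simp: modulus_def chain_coeff_def wt_def)
    show "modulus m (Suc j) dvd modulus m j" if "Suc j < d m" for j
      using that by (rule modulus_dvd)
    \<comment> \<open>A preimage of \<open>b m i\<close> under \<open>D\<close> has a part in the
      image of \<open>U\<close>. Dropping that part changes the coordinates by those of an element
      of the image of \<open>DU\<close>, that is, by multiples of the moduli.\<close>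
    fix i assume i: "i < d m"
    then have "b m i \<in> V m" using adapted_V[OF ad] by simp
    then obtain w where w: "w \<in> V (Suc m)" "dn m w = b m i" using dn_surj by blast
    obtain u a where u: "u \<in> V m" and wa: "w = (\<lambda>x. up m u x + (\<Sum>k<?D. a k * c1 k x))"
      using c1 w(1) unfolding complements_def by blast
    have "b m i = dn m (\<lambda>x. 1 * up m u x + 1 * (\<Sum>k<?D. a k * c1 k x))"
      using w(2) wa by simp
    also have "\<dots> = (\<lambda>x. dn m (up m u) x + (\<Sum>j<d m. (\<Sum>k<?D. \<Phi> k j * a k) * b m j x))"
      unfolding dn_lincomb dn_comb by simp
    finally have bi: "b m i = \<dots>" .
    have DUu: "dn m (up m u) = (\<lambda>x. \<Sum>j<d m. ((if j = i then 1 else 0) - (\<Sum>k<?D. \<Phi> k j * a k)) * b m j x)"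
    proof
      fix x
      have "(\<Sum>j<d m. (if j = i then 1 else 0) * b m j x) = (\<Sum>j<d m. if j = i then b m j x else 0)"
        by (rule sum.cong) auto
      also have "\<dots> = b m i x" using i by simp
      finally show "dn m (up m u) x
          = (\<Sum>j<d m. ((if j = i then 1 else 0) - (\<Sum>k<?D. \<Phi> k j * a k)) * b m j x)"
        using fun_cong[OF bi, of x] by (simp add: left_diff_distrib sum_subtractf)
    qed
    have "modulus m j dvd (if j = i then 1 else 0) - (\<Sum>k<?D. \<Phi> k j * a k)" if "j < d m" for j
      using modulus_dvd_coeff[OF ad u DUu that] .
    moreover have "\<phi> j (\<lambda>l. \<Sum>k<?D. a k * \<delta> k l) = (\<Sum>k<?D. \<Phi> k j * a k)" for j
      unfolding \<phi>_def by (rule sum.cong) (simp_all add: \<delta>_sum)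
    ultimately have "\<forall>j<d m. modulus m j dvd \<phi> j (\<lambda>l. \<Sum>k<?D. a k * \<delta> k l) - (if j = i then 1 else 0)"
      by (metis dvd_minus_iff minus_diff_eq)
    then show "\<exists>v\<in>lspan {..<?D} \<delta>. \<forall>j<d m. modulus m j dvd \<phi> j v - (if j = i then 1 else 0)"
      by (intro bexI[of _ "\<lambda>l. \<Sum>k<?D. a k * \<delta> k l"]) (auto intro: lspanI)
  qed
  then obtain A where A: "lspan {..<?D} A = lspan {..<?D} \<delta>"
    and Am: "\<And>k j. k < ?D \<Longrightarrow> j < d m \<Longrightarrow> modulus m j dvd \<phi> j (A k) - (if j = k then 1 else 0)"
    by blast
  define c2 where "c2 = (\<lambda>k x. \<Sum>l<?D. A k l * c1 l x)"
  have c2: "complements m c2"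
  proof (rule complements_change[OF c1])
    show "c2 k \<in> V (Suc m)" for k
      unfolding c2_def using c1 by (intro V_sum) (auto simp: complements_def)
    fix l assume l: "l < ?D"
    have "\<delta> l \<in> lspan {..<?D} A" unfolding A using l by (intro lspan_base) auto
    then obtain a where a: "\<delta> l = (\<lambda>t. \<Sum>k<?D. a k * A k t)" by (rule lspanE)
    show "c1 l \<in> lspan {..<?D} c2"
    proof (rule lspanI)
      fix x
      have "(\<Sum>k<?D. a k * c2 k x) = (\<Sum>k<?D. \<Sum>t<?D. a k * (A k t * c1 t x))"
        unfolding c2_def by (simp add: sum_distrib_left)
      also have "\<dots> = (\<Sum>t<?D. \<Sum>k<?D. a k * (A k t * c1 t x))"
        by (rule sum.swap)
      also have "\<dots> = (\<Sum>t<?D. \<delta> l t * c1 t x)"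
        unfolding a by (simp add: sum_distrib_right mult.assoc)
      also have "\<dots> = (\<Sum>t<?D. if t = l then c1 t x else 0)"
        by (rule sum.cong) (auto simp: \<delta>_def)
      also have "\<dots> = c1 l x" using l by simp
      finally show "c1 l x = (\<Sum>k<?D. a k * c2 k x)" by simp
    qed
  qed
  \<comment> \<open>The excess over the wanted coordinates, counted in moduli;
    \<open>DU (w k)\<close> below cancels it exactly.\<close>
  define t where "t = (\<lambda>k j. (\<phi> j (A k) - (if j = k then 1 else 0)) div modulus m j)"
  have t: "\<phi> j (A k) = (if j = k then 1 else 0) + modulus m j * t k j" if "k < ?D" "j < d m" for k j
    using dvd_mult_div_cancel[OF Am[OF that]] by (simp add: t_def)
  have "\<forall>j\<in>{..<d m}. \<exists>u. u \<in> V m \<and> dn m (up m u) = (\<lambda>x. modulus m j * b m j x)"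
    using ex_dn_up_eq_modulus[OF ad] by auto
  from bchoice[OF this] obtain uu where uuV: "\<And>j. j < d m \<Longrightarrow> uu j \<in> V m"
    and uu: "\<And>j. j < d m \<Longrightarrow> dn m (up m (uu j)) = (\<lambda>x. modulus m j * b m j x)"
    by auto
  define w where "w = (\<lambda>k x. \<Sum>j<d m. (- t k j) * uu j x)"
  have wV: "w k \<in> V m" for k
    unfolding w_def by (rule V_sum) (simp add: uuV)
  define c3 where "c3 = (\<lambda>k x. 1 * c2 k x + 1 * up m (w k) x)"
  have c3: "complements m c3"
    unfolding c3_def using wV by (intro complements_shift[OF c2])
  have dn_c3: "dn m (c3 k) = (if k < d m then b m k else (\<lambda>x. 0))" if k: "k < ?D" for k
  proof
    fix x
    have "dn m (up m (w k)) x = (\<Sum>j<d m. (- t k j) * dn m (up m (uu j)) x)"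
      unfolding w_def up_sum dn_sum ..
    also have "\<dots> = (\<Sum>j<d m. (- t k j) * (modulus m j * b m j x))"
      using uu by (intro sum.cong) auto
    finally have w: "dn m (up m (w k)) x = \<dots>" .
    have "dn m (c3 k) x = (\<Sum>j<d m. \<phi> j (A k) * b m j x) + (\<Sum>j<d m. (- t k j) * (modulus m j * b m j x))"
      unfolding c3_def dn_lincomb w c2_def dn_comb \<phi>_def by simp
    also have "\<dots> = (\<Sum>j<d m. if j = k then b m j x else 0)"
      unfolding sum.distrib[symmetric] using t k by (intro sum.cong) (auto simp: algebra_simps)
    also have "\<dots> = (if k < d m then b m k else (\<lambda>x. 0)) x" by simp
    finally show "dn m (c3 k) x = (if k < d m then b m k else (\<lambda>x. 0)) x" .
  qed
  let ?b = "b(Suc m := c3)"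
  have lift_old: "lift ?b (Suc m) i j = up m (lift b m i j)" if "i \<le> m" for i j
    using that by (simp add: lift_update)
  have "adapted ?b (Suc m)"
    unfolding adapted_def
  proof (intro conjI allI impI subsetI)
    show "?b i j \<in> V i" if "i \<le> Suc m" "j < d i" for i j
      using that c3 adapted_V[OF ad, of i j] by (auto simp: complements_def le_Suc_eq)
    show "dn i (?b (Suc i) j) = (if j < d i then ?b i j else (\<lambda>x. 0))" if "i < Suc m" "j < d (Suc i)" for i j
      using that dn_c3[of j] adapted_dn[OF ad, of i j] by (auto simp: less_Suc_eq)
    fix v assume "v \<in> V (Suc m)"
    then obtain u a where u: "u \<in> V m" and v: "v = (\<lambda>x. up m u x + (\<Sum>k<?D. a k * c3 k x))"
      using c3 unfolding complements_def by blast
    obtain \<alpha> where \<alpha>: "u = (\<lambda>x. \<Sum>(i, j)\<in>K m. \<alpha> i j * lift b m i j x)"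
      using adapted_span[OF ad u] .
    let ?L = "\<lambda>(i, j). lift ?b (Suc m) i j"
    have "up m u = (\<lambda>x. \<Sum>k\<in>K m. (case k of (i, j) \<Rightarrow> \<alpha> i j) * ?L k x)"
      unfolding \<alpha> case_prod_unfold up_sum
      by (intro ext sum.cong) (auto simp: lift_old in_K simp del: lift.simps)
    also have "\<dots> \<in> lspan (K (Suc m)) ?L"
      by (rule lspan_sum, rule lspan_base[OF finite_K]) (auto simp: in_K)
    finally have 1: "up m u \<in> lspan (K (Suc m)) ?L" .
    have "c3 k \<in> lspan (K (Suc m)) ?L" if "k < ?D" for k
      using lspan_base[OF finite_K, of "(Suc m, k)" "Suc m" ?L] that by (simp add: in_K)
    then have "(\<lambda>x. \<Sum>k<?D. a k * c3 k x) \<in> lspan (K (Suc m)) ?L"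
      by (intro lspan_sum) auto
    from lspan_lincomb[OF 1 this, of 1 1] show "v \<in> lspan (K (Suc m)) ?L"
      unfolding v by simp
  qed
  then show ?thesis by blast
qed

lemma ex_adapted: "\<exists>b. adapted b n"
proof (induction n)
  case 0
  obtain hx where hx: "bij_betw hx {..<d 0} (X 0)"
    using ex_bij_betw_nat_finite[OF finite_X[of 0]] by (auto simp: card_0 lessThan_atLeast0)
  define b :: "nat \<Rightarrow> nat \<Rightarrow> 'v \<Rightarrow> int" where "b = (\<lambda>i j x. if x = hx j then 1 else 0)"
  have K0: "K 0 = Pair 0 ` {..<d 0}" by (auto simp: K_def)
  have "v \<in> lspan (K 0) (\<lambda>(i, j). lift b 0 i j)" if v: "v \<in> V 0" for v
  proof (rule lspanI)
    fix x
    have "(\<Sum>k\<in>K 0. v (hx (snd k)) * (\<lambda>(i, j). lift b 0 i j) k x) = (\<Sum>j<d 0. v (hx j) * b 0 j x)"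
      by (simp add: K0 sum.reindex inj_on_def)
    also have "\<dots> = (\<Sum>x'\<in>X 0. v x' * (if x = x' then 1 else 0))"
      unfolding b_def by (rule sum.reindex_bij_betw[OF hx])
    also have "\<dots> = (\<Sum>x'\<in>X 0. if x = x' then v x' else 0)"
      by (rule sum.cong) auto
    also have "\<dots> = v x" using v finite_X by (auto simp: V_def)
    finally show "v x = (\<Sum>k\<in>K 0. v (hx (snd k)) * (\<lambda>(i, j). lift b 0 i j) k x)" by simp
  qed
  moreover have "b 0 j \<in> V 0" if "j < d 0" for j
    using hx that unfolding b_def by (intro delta_V) (auto simp: bij_betw_def)
  ultimately have "adapted b 0" by (auto simp: adapted_def)
  then show ?case by blast
next
  case (Suc n)
  then show ?case using adapted_step by blast
qed

section \<open>Diagonalization of \<open>DU + x\<close>\<close>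

lemma has_smith_normal_form_DU_plus_xI:
  assumes es: "distinct es" "set es = X n"
  shows "has_smith_normal_form (mat (length es) (length es)
    (\<lambda>(i, j). of_int (\<Sum>z\<in>X (Suc n). e (es ! i) z * e (es ! j) z)
       + (if i = j then [:0, 1:] else 0 :: int poly)))"
    (is "has_smith_normal_form ?M")
proof -
  obtain b where ad: "adapted b n" using ex_adapted by blast
  define N where "N = length es"
  define L :: "nat \<Rightarrow> nat \<Rightarrow> 'v \<Rightarrow> int poly" where "L = (\<lambda>i j x. of_int (lift b n i j x))"
  define f :: "nat \<Rightarrow> int poly" where "f = (\<lambda>i. of_int (wt n i) + [:0, 1:])"
  define h where "h = (\<lambda>i k. \<Prod>l=i..<k. - f l)"
  define inner where "inner = (\<lambda>i j. 0 < i \<and> j < d (i - 1))"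
  \<comment> \<open>In the source the start of each chain is replaced by the combination that
    telescopes under \<open>DU + x\<close>. In the target the inner members give way to their
    negated images, and the start to the top \<open>L n j\<close>.\<close>
  define \<beta> where "\<beta> = (\<lambda>(i, j). if inner i j then L i j else (\<lambda>x. \<Sum>k=i..n. h i k * L k j x))"
  define \<gamma> where "\<gamma> = (\<lambda>(i, j). if inner i j then (\<lambda>x. - (f i * L i j x + L (i - 1) j x)) else L n j)"
  \<comment> \<open>The sign makes \<open>S 0 = - 1\<close> and \<open>S (Suc n - i) = h i n * f n\<close>, so that one formula in the sort key
    gives all diagonal entries.\<close>
  define S where "S = (\<lambda>t. - (\<Prod>l=Suc n - t..n. - f l))"
  \<comment> \<open>Units come first, then the chains by length: one that starts in rank
    \<open>i\<close> has \<open>Suc n - i\<close> members.\<close>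
  define key where "key = (\<lambda>(i, j). if inner i j then 0 else Suc n - i)"

  have bij: "bij_betw (\<lambda>k. es ! k) {..<N} (X n)"
    using es by (intro bij_betw_nth) (auto simp: N_def)
  have M_L: "(\<Sum>j'<N. ?M $$ (i', j') * L i j (es ! j'))
      = f i * L i j (es ! i') + (if inner i j then L (i - 1) j (es ! i') else 0)"
    if "i' < N" "i \<le> n" "j < d i" for i' i j
  proof -
    let ?E = "\<lambda>y u. \<Sum>z\<in>X (Suc n). e y z * e u z"
    let ?y = "es ! i'"
    have y: "?y \<in> X n" using es(2) nth_mem[of i' es] that(1) by (simp add: N_def)
    have "(\<Sum>j'<N. ?M $$ (i', j') * L i j (es ! j'))
        = (\<Sum>j'<N. of_int (?E ?y (es ! j') * lift b n i j (es ! j'))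
             + (if i' = j' then [:0, 1:] * L i j (es ! j') else 0))"
      using that by (intro sum.cong) (auto simp: N_def L_def distrib_right)
    also have "\<dots> = of_int (\<Sum>j'<N. ?E ?y (es ! j') * lift b n i j (es ! j')) + [:0, 1:] * L i j ?y"
      using that by (simp add: sum.distrib)
    also have "(\<Sum>j'<N. ?E ?y (es ! j') * lift b n i j (es ! j')) = dn n (up n (lift b n i j)) ?y"
      unfolding dn_up_eq[OF y] by (rule sum.reindex_bij_betw[OF bij])
    also have "\<dots> = wt n i * lift b n i j ?y + (if inner i j then lift b n (i - 1) j ?y else 0)"
      using adapted_dn_up_lift[OF ad, of i j] that by (simp add: inner_def)
    finally show ?thesis by (simp add: f_def L_def distrib_right)
  qed
  have L_span: "(\<lambda>x'. if x' = x then 1 else 0) \<in> lspan (K n) (\<lambda>(i, j). L i j)" if x: "x \<in> X n" for x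
  proof -
    obtain \<alpha> where \<alpha>: "(\<lambda>x'. if x' = x then 1 else 0) = (\<lambda>x'. \<Sum>(i, j)\<in>K n. \<alpha> i j * lift b n i j x')"
      using adapted_span[OF ad delta_V[OF x]] .
    show ?thesis
    proof (rule lspanI)
      fix x'
      have "(if x' = x then 1 else 0 :: int poly) = of_int (if x' = x then 1 else 0)" by simp
      also have "\<dots> = of_int (\<Sum>(i, j)\<in>K n. \<alpha> i j * lift b n i j x')"
        using fun_cong[OF \<alpha>, of x'] by simp
      also have "\<dots> = (\<Sum>k\<in>K n. of_int (\<alpha> (fst k) (snd k)) * (\<lambda>(i, j). L i j) k x')"
        by (simp add: L_def case_prod_unfold)
      finally show "(if x' = x then 1 else 0) = (\<Sum>k\<in>K n. of_int (\<alpha> (fst k) (snd k)) * (\<lambda>(i, j). L i j) k x')" .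
    qed
  qed
  have inner_above: "inner k j" if "i < k" "j < d i" for i j k
    using that d_mono[of i "k - 1"] by (cases k) (auto simp: inner_def)
  have \<beta>_span: "lspan (K n) (\<lambda>(i, j). L i j) \<subseteq> lspan (K n) \<beta>"
  proof (rule lspan_subset, clarify)
    fix i j assume "(i, j) \<in> K n"
    then have i: "i \<le> n" and j: "j < d i" by (auto simp: in_K)
    have \<beta>K: "\<beta> (k, j) \<in> lspan (K n) \<beta>" if "i \<le> k" "k \<le> n" for k
      using that j d_mono[of i k] by (intro lspan_base finite_K) (auto simp: in_K)
    show "L i j \<in> lspan (K n) \<beta>"
    proof (cases "inner i j")
      case True
      then show ?thesis using \<beta>K[of i] i by (simp add: \<beta>_def)
    next
      case False
      \<comment> \<open>The change is unitriangular, since \<open>h i i = 1\<close> and all later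
        members of the chain are inner.\<close>
      have "L i j = (\<lambda>x. 1 * \<beta> (i, j) x + (-1) * (\<Sum>k=Suc i..n. h i k * \<beta> (k, j) x))"
      proof
        fix x
        have "\<beta> (i, j) x = L i j x + (\<Sum>k=Suc i..n. h i k * L k j x)"
          using False i by (simp add: \<beta>_def sum.atLeast_Suc_atMost h_def)
        moreover have "(\<Sum>k=Suc i..n. h i k * L k j x) = (\<Sum>k=Suc i..n. h i k * \<beta> (k, j) x)"
          using inner_above[OF _ j] by (intro sum.cong) (auto simp: \<beta>_def Suc_le_eq)
        ultimately show "L i j x = 1 * \<beta> (i, j) x + (-1) * (\<Sum>k=Suc i..n. h i k * \<beta> (k, j) x)" by simp
      qed
      also have "\<dots> \<in> lspan (K n) \<beta>"
        using \<beta>K i by (intro lspan_lincomb lspan_sum) auto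
      finally show ?thesis .
    qed
  qed
  have \<gamma>_span: "lspan (K n) (\<lambda>(i, j). L i j) \<subseteq> lspan (K n) \<gamma>"
  proof (rule lspan_subset, clarify)
    fix i j assume "(i, j) \<in> K n"
    then have i: "i \<le> n" and j: "j < d i" by (auto simp: in_K)
    \<comment> \<open>The top of the chain is the target vector of its start; going down, the image
      of each member yields its predecessor.\<close>
    from i show "L i j \<in> lspan (K n) \<gamma>"
    proof (induction rule: inc_induct)
      case base
      let ?i = "chain_start j"
      have le: "?i \<le> k \<longleftrightarrow> j < d k" for k by (rule chain_start_le_iff[OF j])
      have "(?i, j) \<in> K n" using le[of i] le[of ?i] i j by (simp add: in_K)
      moreover have "\<not> inner ?i j" using le[of "?i - 1"] by (auto simp: inner_def)
      ultimately show ?case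
        using lspan_base[OF finite_K, of "(?i, j)" n \<gamma>] by (simp add: \<gamma>_def)
    next
      case (step k)
      have jk: "j < d k" "j < d (Suc k)" using j d_mono[of i k] d_mono[of i "Suc k"] step.hyps by auto
      have "\<gamma> (Suc k, j) \<in> lspan (K n) \<gamma>"
        using jk step.hyps by (intro lspan_base finite_K) (auto simp: in_K)
      from lspan_lincomb[OF this step.IH, of "-1" "- f (Suc k)"] show ?case
        using jk by (simp add: \<gamma>_def inner_def)
    qed
  qed
  obtain ks0 where ks0: "set ks0 = K n" "distinct ks0"
    using finite_distinct_list[OF finite_K] by blast
  define ks where "ks = sort_key key ks0"
  have ks: "set ks = K n" "distinct ks" "sorted (map key ks)"
    using ks0 by (auto simp: ks_def)
  have len: "length ks = N"
    using distinct_card[OF ks(2)] distinct_card[OF es(1)] ks(1) es(2) by (simp add: card_K N_def)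
  show ?thesis
  proof (rule has_smith_normal_form_from_spanning_families[where es = es and ks = ks and \<beta> = \<beta> and \<gamma> = \<gamma>
        and s = "\<lambda>k. S (key k)" and N = N])
    show "?M \<in> carrier_mat N N" by (simp add: N_def)
    show "(\<lambda>x'. if x' = x then 1 else 0) \<in> lspan (set ks) \<beta>" if "x \<in> set es" for x
      using L_span[of x] \<beta>_span that ks es by auto
    show "(\<lambda>x'. if x' = x then 1 else 0) \<in> lspan (set ks) \<gamma>" if "x \<in> set es" for x
      using L_span[of x] \<gamma>_span that ks es by auto
    show "S (key (ks ! i)) dvd S (key (ks ! Suc i))" if "Suc i < N" for i
    proof -
      have "key (ks ! i) \<le> key (ks ! Suc i)"
        using sorted_nth_mono[OF ks(3), of i "Suc i"] that len by simp
      \<comment> \<open>\<open>S t\<close> has the factors of the top \<open>t\<close> ranks, so a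
        larger key gives a multiple.\<close>
      then show ?thesis unfolding S_def by (auto intro!: prod_dvd_prod_subset)
    qed
    fix i' k assume i': "i' < N" and "k \<in> set ks"
    then obtain i j where k: "k = (i, j)" and i: "i \<le> n" and j: "j < d i"
      using ks by (cases k) (auto simp: in_K)
    show "(\<Sum>j'<N. ?M $$ (i', j') * \<beta> k (es ! j')) = S (key k) * \<gamma> k (es ! i')"
    proof (cases "inner i j")
      case True
      then show ?thesis
        using M_L[OF i' i j] by (simp add: k \<beta>_def \<gamma>_def key_def S_def)
    next
      case False
      have "(\<Sum>j'<N. ?M $$ (i', j') * \<beta> k (es ! j'))
          = (\<Sum>j'<N. \<Sum>l=i..n. h i l * (?M $$ (i', j') * L l j (es ! j')))"
        by (simp only: k \<beta>_def prod.case False if_False sum_distrib_left mult.left_commute)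
      also have "\<dots> = (\<Sum>l=i..n. \<Sum>j'<N. h i l * (?M $$ (i', j') * L l j (es ! j')))"
        by (rule sum.swap)
      also have "\<dots> = (\<Sum>l=i..n. h i l * (f l * L l j (es ! i') + (if i < l then L (l - 1) j (es ! i') else 0)))"
      proof (rule sum.cong)
        fix l assume l: "l \<in> {i..n}"
        then have jl: "j < d l" using j d_mono[of i l] by simp
        have "inner l j \<longleftrightarrow> i < l"
          using l False inner_above[OF _ j, of l] by (cases "i = l") auto
        then show "(\<Sum>j'<N. h i l * (?M $$ (i', j') * L l j (es ! j')))
            = h i l * (f l * L l j (es ! i') + (if i < l then L (l - 1) j (es ! i') else 0))"
          using M_L[OF i' _ jl] l by (simp add: sum_distrib_left[symmetric])
      qed simp
      also have "\<dots> = h i n * f n * L n j (es ! i')"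
        using i by (intro chain_sum) (auto simp: h_def prod.atLeastLessThan_Suc)
      also have "h i n * f n = S (Suc n - i)"
      proof -
        have "(\<Prod>l=i..n. - f l) = (\<Prod>l=i..<n. - f l) * - f n"
          using i by (metis atLeastLessThanSuc_atLeastAtMost prod.atLeastLessThan_Suc)
        then show ?thesis using i by (simp add: S_def h_def)
      qed
      finally show ?thesis using False by (simp add: k \<gamma>_def key_def)
    qed
  qed (use es ks len in \<open>auto simp: N_def\<close>)
qed

end

section \<open>Differential posets\<close>

definition cov_ind :: "'a set \<Rightarrow> ('a \<Rightarrow> 'a \<Rightarrow> bool) \<Rightarrow> 'a \<Rightarrow> 'a \<Rightarrow> int" where
  "cov_ind S leq x y = (if covby S leq x y then 1 else 0)"

lemma sum_cov_ind_up:
  assumes "finite A" "{z \<in> S. covby S leq u z \<and> covby S leq v z} \<subseteq> A"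
  shows "(\<Sum>z\<in>A. cov_ind S leq u z * cov_ind S leq v z) = int (card {z \<in> S. covby S leq u z \<and> covby S leq v z})"
proof -
  have "(\<Sum>z\<in>A. cov_ind S leq u z * cov_ind S leq v z)
      = (\<Sum>z\<in>{z \<in> S. covby S leq u z \<and> covby S leq v z}. 1)"
    using assms by (intro sum.mono_neutral_cong_right) (auto simp: cov_ind_def covby_def)
  then show ?thesis by simp
qed

lemma sum_cov_ind_down:
  assumes "finite A" "{z \<in> S. covby S leq z u \<and> covby S leq z v} \<subseteq> A"
  shows "(\<Sum>z\<in>A. cov_ind S leq z u * cov_ind S leq z v) = int (card {z \<in> S. covby S leq z u \<and> covby S leq z v})"
proof -
  have "(\<Sum>z\<in>A. cov_ind S leq z u * cov_ind S leq z v)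
      = (\<Sum>z\<in>{z \<in> S. covby S leq z u \<and> covby S leq z v}. 1)"
    using assms by (intro sum.mono_neutral_cong_right) (auto simp: cov_ind_def covby_def)
  then show ?thesis by simp
qed

section \<open>Uniqueness of rank functions\<close>

definition pointed_poset :: "'a set \<Rightarrow> ('a \<Rightarrow> 'a \<Rightarrow> bool) \<Rightarrow> 'a \<Rightarrow> bool" where
  "pointed_poset S leq m \<longleftrightarrow> partial_order_on' S leq \<and> locally_finite S leq \<and> m \<in> S \<and> (\<forall>x\<in>S. leq m x)"

lemma pointed_poset_minimal:
  assumes "pointed_poset S leq m" "x \<in> S" "leq x m"
  shows "x = m"
  using assms unfolding pointed_poset_def partial_order_on'_def by blast

text \<open>Among the elements strictly below \<open>x\<close>, take one with the largest interval
  down to the minimum: anything strictly between it and \<open>x\<close> would have a larger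
  one.\<close>

lemma ex_covby_below:
  assumes P: "pointed_poset S leq m" and x: "x \<in> S" "x \<noteq> m"
  shows "\<exists>y. covby S leq y x"
proof -
  have refl: "leq a a" if "a \<in> S" for a
    using P that unfolding pointed_poset_def partial_order_on'_def by blast
  have anti: "a = b" if "a \<in> S" "b \<in> S" "leq a b" "leq b a" for a b
    using P that unfolding pointed_poset_def partial_order_on'_def by blast
  have trans: "leq a c" if "a \<in> S" "b \<in> S" "c \<in> S" "leq a b" "leq b c" for a b c
    using P that unfolding pointed_poset_def partial_order_on'_def by blast
  have m: "m \<in> S" and mle: "\<And>a. a \<in> S \<Longrightarrow> leq m a"
    using P unfolding pointed_poset_def by auto
  define J where "J = (\<lambda>y. {z \<in> S. leq m z \<and> leq z y})"
  have finJ: "finite (J y)" if "y \<in> S" for y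
    using P that m unfolding pointed_poset_def locally_finite_def J_def by blast
  define I where "I = J x - {x}"
  have "finite I" "m \<in> I"
    using finJ[OF x(1)] x m mle refl by (auto simp: I_def J_def)
  then have "Max ((\<lambda>y. card (J y)) ` I) \<in> (\<lambda>y. card (J y)) ` I"
    by (intro Max_in) auto
  then obtain y where y: "y \<in> I" and ymax: "card (J y) = Max ((\<lambda>y. card (J y)) ` I)"
    by auto
  have max: "card (J z) \<le> card (J y)" if "z \<in> I" for z
    unfolding ymax using \<open>finite I\<close> that by (intro Max_ge) auto
  have yS: "y \<in> S" "leq y x" "y \<noteq> x" using y by (auto simp: I_def J_def)
  have "z = y \<or> z = x" if z: "z \<in> S" "leq y z" "leq z x" for z
  proof (rule ccontr)
    assume "\<not> (z = y \<or> z = x)"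
    then have "z \<in> I" "z \<noteq> y" using z mle by (auto simp: I_def J_def)
    have "J y \<subset> J z"
    proof
      show "J y \<subseteq> J z" using trans[of _ y z] z yS by (auto simp: J_def)
      have "z \<in> J z" "z \<notin> J y" using z yS anti \<open>z \<noteq> y\<close> refl mle by (auto simp: J_def)
      then show "J y \<noteq> J z" by blast
    qed
    then have "card (J y) < card (J z)" using finJ[OF z(1)] by (rule psubset_card_mono[rotated])
    with max[OF \<open>z \<in> I\<close>] show False by simp
  qed
  then have "covby S leq y x" using yS x unfolding covby_def by blast
  then show ?thesis by blast
qed

lemma rank_fun_covby: "is_rank_fun S leq rk \<Longrightarrow> covby S leq x y \<Longrightarrow> rk y = Suc (rk x)"
  unfolding is_rank_fun_def by simp

lemma rank_fun_min:
  assumes "pointed_poset S leq m" "is_rank_fun S leq rk"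
  shows "rk m = 0"
proof -
  have "m \<in> S" using assms by (simp add: pointed_poset_def)
  then show ?thesis
    using assms pointed_poset_minimal[OF assms(1)] unfolding is_rank_fun_def by blast
qed

text \<open>Descending through covers reaches the minimum, so the rank is forced. As
  \<open>rank_of\<close> is an arbitrary choice, this is what makes the rank in a product the sum of
  the ranks.\<close>

lemma rank_fun_unique:
  assumes P: "pointed_poset S leq m" and rk: "is_rank_fun S leq rk" "is_rank_fun S leq rk'" and "x \<in> S"
  shows "rk x = rk' x"
  using \<open>x \<in> S\<close>
proof (induction "rk x" arbitrary: x rule: less_induct)
  case less
  show ?case
  proof (cases "x = m")
    case True
    then show ?thesis using rank_fun_min[OF P rk(1)] rank_fun_min[OF P rk(2)] by simp
  next
    case False
    then obtain y where y: "covby S leq y x" using ex_covby_below[OF P less.prems] by blast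
    then have "y \<in> S" by (simp add: covby_def)
    then show ?thesis
      using less.hyps[of y] rank_fun_covby[OF rk(1) y] rank_fun_covby[OF rk(2) y] by simp
  qed
qed

section \<open>A single differential poset\<close>

locale differential_poset =
  fixes S :: "'a set" and leq :: "'a \<Rightarrow> 'a \<Rightarrow> bool" and r :: nat
  assumes diff: "differential S leq r"
begin

abbreviation "rk \<equiv> rank_of S leq"

definition bt where "bt = (SOME m. pointed_poset S leq m)"

lemma pointed: "pointed_poset S leq bt"
proof -
  have "\<exists>m. pointed_poset S leq m"
    using diff unfolding differential_def has_unique_min_def pointed_poset_def by blast
  then show ?thesis unfolding bt_def by (rule someI_ex)
qed

lemma r_pos: "r > 0" using diff by (simp add: differential_def)

lemma rank_fun: "is_rank_fun S leq rk"
  using diff unfolding differential_def graded_def rank_of_def by (metis someI_ex)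

lemma bt_in: "bt \<in> S" using pointed by (simp add: pointed_poset_def)

lemma rank_covby: "covby S leq x y \<Longrightarrow> rk y = Suc (rk x)"
  by (rule rank_fun_covby[OF rank_fun])

lemma finite_rank_set: "finite (rank_set S leq n)"
  using diff by (simp add: differential_def)

lemma finite_up: "finite {z \<in> S. covby S leq x z}"
  by (rule finite_subset[OF _ finite_rank_set[of "Suc (rk x)"]]) (auto simp: rank_set_def rank_covby)

lemma finite_down: "finite {z \<in> S. covby S leq z x}"
  by (rule finite_subset[OF _ finite_rank_set[of "rk x - 1"]]) (auto simp: rank_set_def rank_covby)

text \<open>(D2) and (D3) in one formula: the entries of \<open>DU - UD = r\<close>.\<close>

lemma card_common_covers:
  assumes "u \<in> S" "v \<in> S"
  shows "card {z \<in> S. covby S leq u z \<and> covby S leq v z}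
    = card {z \<in> S. covby S leq z u \<and> covby S leq z v} + (if u = v then r else 0)"
  using diff assms unfolding differential_def by auto

lemma sum_cov_ind:
  assumes "u \<in> S" "v \<in> S" "finite A" "finite B"
    "{z \<in> S. covby S leq u z} \<subseteq> A" "{z \<in> S. covby S leq z u} \<subseteq> B"
  shows "(\<Sum>z\<in>A. cov_ind S leq u z * cov_ind S leq v z)
    = (\<Sum>z\<in>B. cov_ind S leq z u * cov_ind S leq z v) + (if u = v then int r else 0)"
proof -
  have "(\<Sum>z\<in>A. cov_ind S leq u z * cov_ind S leq v z) = int (card {z \<in> S. covby S leq u z \<and> covby S leq v z})"
    using assms by (intro sum_cov_ind_up) auto
  moreover have "(\<Sum>z\<in>B. cov_ind S leq z u * cov_ind S leq z v) = int (card {z \<in> S. covby S leq z u \<and> covby S leq z v})"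
    using assms by (intro sum_cov_ind_down) auto
  ultimately show ?thesis using card_common_covers[OF assms(1,2)] by simp
qed

lemma rank_eq_0_iff:
  assumes "x \<in> S"
  shows "rk x = 0 \<longleftrightarrow> x = bt"
proof
  assume "rk x = 0"
  then have "\<not> covby S leq y x" for y using rank_covby[of y x] by auto
  then show "x = bt" using ex_covby_below[OF pointed assms] by blast
qed (use rank_fun_min[OF pointed rank_fun] in simp)

lemma rank_set_0: "rank_set S leq 0 = {bt}"
  using rank_eq_0_iff bt_in by (auto simp: rank_set_def)

lemma rank_size_0: "rank_size S leq 0 = 1"
  by (simp add: rank_size_def rank_set_0)

lemma rank_set_Suc: "rank_set S leq (Suc n) = (\<Union>y\<in>rank_set S leq n. {z \<in> S. covby S leq y z})"
proof (intro equalityI subsetI)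
  fix x assume x: "x \<in> rank_set S leq (Suc n)"
  then have "x \<in> S" "x \<noteq> bt" using rank_eq_0_iff[OF bt_in] by (auto simp: rank_set_def)
  then obtain y where "covby S leq y x" using ex_covby_below[OF pointed] by blast
  with x rank_covby[OF this] show "x \<in> (\<Union>y\<in>rank_set S leq n. {z \<in> S. covby S leq y z})"
    by (auto simp: rank_set_def covby_def)
qed (auto simp: rank_set_def rank_covby)

lemma card_covers: "x \<in> S \<Longrightarrow> card {z \<in> S. covby S leq x z} = card {z \<in> S. covby S leq z x} + r"
  using diff by (simp add: differential_def)

lemma down_eq_rank_set:
  assumes "x \<in> S" "rk x = Suc n" "rank_set S leq n = {y}"
  shows "{z \<in> S. covby S leq z x} = {y}"
proof -
  have "x \<noteq> bt" using assms rank_eq_0_iff[OF bt_in] by auto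
  then obtain z where "covby S leq z x" using ex_covby_below[OF pointed assms(1)] by blast
  moreover have "z = y" if "covby S leq z x" for z
  proof -
    have "z \<in> rank_set S leq n"
      using rank_covby[OF that] that assms(2) by (simp add: rank_set_def covby_def)
    then show ?thesis using assms(3) by simp
  qed
  ultimately show ?thesis by (auto simp: covby_def)
qed

lemma rank_size_1: "rank_size S leq 1 = r"
proof -
  have "{z \<in> S. covby S leq z bt} = {}"
    using rank_covby[of _ bt] rank_eq_0_iff[OF bt_in] by auto
  then have "card {z \<in> S. covby S leq z bt} = 0" by (simp only: card.empty)
  then show ?thesis
    using card_covers[OF bt_in] rank_set_Suc[of 0] by (simp add: rank_size_def rank_set_0)
qed

text \<open>The single element of rank 1 covers just the minimum, so two elements cover it. This
  value decides the growth of the product when \<open>s = 1\<close>.\<close>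

lemma rank_size_2:
  assumes "r = 1"
  shows "rank_size S leq 2 = 2"
proof -
  obtain a where a: "rank_set S leq 1 = {a}"
    using rank_size_1 assms by (auto simp: rank_size_def card_1_singleton_iff)
  then have "a \<in> S" "rk a = Suc 0" by (auto simp: rank_set_def)
  then have "{z \<in> S. covby S leq z a} = {bt}"
    by (rule down_eq_rank_set) (rule rank_set_0)
  then show ?thesis
    using card_covers[OF \<open>a \<in> S\<close>] rank_set_Suc[of 1] a assms
    by (simp add: rank_size_def numeral_2_eq_2)
qed

lemma rank_size_pos: "rank_size S leq n > 0"
proof -
  have "rank_set S leq n \<noteq> {}"
  proof (induction n)
    case 0
    show ?case by (simp add: rank_set_0)
  next
    case (Suc n)
    then obtain x where x: "x \<in> rank_set S leq n" by blast
    then have "card {z \<in> S. covby S leq x z} > 0"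
      using card_covers[of x] r_pos by (simp add: rank_set_def)
    then have "{z \<in> S. covby S leq x z} \<noteq> {}" by (metis card.empty less_irrefl)
    with x show ?case unfolding rank_set_Suc by blast
  qed
  then show ?thesis by (simp add: rank_size_def card_gt_0_iff finite_rank_set)
qed

text \<open>\<open>DU = UD + r\<close> is positive definite.\<close>

lemma up_injective:
  assumes zero: "\<And>x. x \<in> rank_set S leq (Suc n) \<Longrightarrow> (\<Sum>y\<in>rank_set S leq n. cov_ind S leq y x * w y) = 0"
    and y: "y \<in> rank_set S leq n"
  shows "w y = 0"
proof -
  let ?X = "rank_set S leq n" and ?Y = "rank_set S leq (Suc n)"
  let ?c = "cov_ind S leq"
  \<comment> \<open>Takes the place of the rank below, which does not exist for
    \<open>n = 0\<close>.\<close>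
  define B where "B = (\<Union>y\<in>?X. {z \<in> S. covby S leq z y})"
  have finB: "finite B" unfolding B_def using finite_rank_set finite_down by blast
  \<comment> \<open>A sum of squares as the quadratic form of a Gram matrix, used forwards for
    \<open>U\<close> and backwards for \<open>D\<close>.\<close>
  have expand: "(\<Sum>x\<in>A. (\<Sum>y\<in>?X. g y x * w y)\<^sup>2) = (\<Sum>y\<in>?X. \<Sum>y'\<in>?X. w y * w y' * (\<Sum>x\<in>A. g y x * g y' x))"
    for A and g :: "'a \<Rightarrow> 'a \<Rightarrow> int"
  proof -
    have "(\<Sum>x\<in>A. (\<Sum>y\<in>?X. g y x * w y)\<^sup>2) = (\<Sum>x\<in>A. \<Sum>y\<in>?X. \<Sum>y'\<in>?X. w y * w y' * (g y x * g y' x))"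
      by (simp add: power2_eq_square sum_product mult_ac)
    also have "\<dots> = (\<Sum>y\<in>?X. \<Sum>x\<in>A. \<Sum>y'\<in>?X. w y * w y' * (g y x * g y' x))"
      by (rule sum.swap)
    also have "\<dots> = (\<Sum>y\<in>?X. \<Sum>y'\<in>?X. \<Sum>x\<in>A. w y * w y' * (g y x * g y' x))"
      by (intro sum.cong refl sum.swap)
    finally show ?thesis by (simp add: sum_distrib_left)
  qed
  have "0 = (\<Sum>x\<in>?Y. (\<Sum>y\<in>?X. ?c y x * w y)\<^sup>2)"
    using zero by simp
  also have "\<dots> = (\<Sum>y\<in>?X. \<Sum>y'\<in>?X. w y * w y' * (\<Sum>x\<in>?Y. ?c y x * ?c y' x))"
    by (rule expand)
  also have "\<dots> = (\<Sum>y\<in>?X. \<Sum>y'\<in>?X. w y * w y' * (\<Sum>z\<in>B. ?c z y * ?c z y')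
      + (if y = y' then int r * (w y)\<^sup>2 else 0))"
  proof (intro sum.cong refl)
    fix y y' assume y: "y \<in> ?X" "y' \<in> ?X"
    then have "(\<Sum>x\<in>?Y. ?c y x * ?c y' x) = (\<Sum>z\<in>B. ?c z y * ?c z y') + (if y = y' then int r else 0)"
      using finB finite_rank_set
      by (intro sum_cov_ind) (auto simp: B_def rank_set_def rank_covby)
    then show "w y * w y' * (\<Sum>x\<in>?Y. ?c y x * ?c y' x) = w y * w y' * (\<Sum>z\<in>B. ?c z y * ?c z y')
      + (if y = y' then int r * (w y)\<^sup>2 else 0)"
      by (simp add: distrib_left power2_eq_square)
  qed
  also have "\<dots> = (\<Sum>y\<in>?X. \<Sum>y'\<in>?X. w y * w y' * (\<Sum>z\<in>B. ?c z y * ?c z y'))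
      + int r * (\<Sum>y\<in>?X. (w y)\<^sup>2)"
    using finite_rank_set by (simp add: sum.distrib sum_distrib_left)
  also have "(\<Sum>y\<in>?X. \<Sum>y'\<in>?X. w y * w y' * (\<Sum>z\<in>B. ?c z y * ?c z y'))
      = (\<Sum>z\<in>B. (\<Sum>y\<in>?X. ?c z y * w y)\<^sup>2)"
    by (rule expand[symmetric])
  finally have "0 = (\<Sum>z\<in>B. (\<Sum>y\<in>?X. ?c z y * w y)\<^sup>2) + int r * (\<Sum>y\<in>?X. (w y)\<^sup>2)" .
  moreover have "(\<Sum>z\<in>B. (\<Sum>y\<in>?X. ?c z y * w y)\<^sup>2) \<ge> 0"
    by (rule sum_nonneg) simp
  ultimately have "int r * (\<Sum>y\<in>?X. (w y)\<^sup>2) \<le> 0" by linarith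
  then have "(\<Sum>y\<in>?X. (w y)\<^sup>2) \<le> 0"
    using r_pos by (simp add: mult_le_0_iff)
  moreover have "(\<Sum>y\<in>?X. (w y)\<^sup>2) \<ge> 0"
    by (rule sum_nonneg) simp
  ultimately have "(\<Sum>y\<in>?X. (w y)\<^sup>2) = 0" by linarith
  then show ?thesis
    using y finite_rank_set by (simp add: sum_nonneg_eq_0_iff)
qed

text \<open>If the rank size dropped, the matrix of \<open>U\<close>, padded with zero rows to a
  square one, would be singular, and a kernel vector would contradict
  \<open>up_injective\<close>.\<close>

lemma rank_size_mono: "rank_size S leq n \<le> rank_size S leq (Suc n)"
proof (rule ccontr)
  assume less: "\<not> rank_size S leq n \<le> rank_size S leq (Suc n)"
  obtain es where es: "set es = rank_set S leq n" "distinct es"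
    using finite_distinct_list[OF finite_rank_set] by blast
  obtain fs where fs: "set fs = rank_set S leq (Suc n)" "distinct fs"
    using finite_distinct_list[OF finite_rank_set] by blast
  define N where "N = length es"
  have len: "length fs < N"
    using less distinct_card[OF es(2)] distinct_card[OF fs(2)] es fs by (simp add: rank_size_def N_def)
  define c where "c = (\<lambda>i. vec N (\<lambda>j. if i < length fs then cov_ind S leq (es ! j) (fs ! i) else 0))"
  define M where "M = mat\<^sub>r N N (\<lambda>i. if i = length fs then 0\<^sub>v N else c i)"
  have "M \<in> carrier_mat N N" by (simp add: M_def)
  moreover have "det M = 0"
    unfolding M_def using len by (intro det_row_0) (auto simp: c_def)
  ultimately obtain v where v: "v \<in> carrier_vec N" "v \<noteq> 0\<^sub>v N" "M *\<^sub>v v = 0\<^sub>v N"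
    using det_0_iff_vec_prod_zero by blast
  define w where "w = (\<lambda>y. v $ (THE j. j < N \<and> es ! j = y))"
  have w: "w (es ! j) = v $ j" if "j < N" for j
  proof -
    have "(THE k. k < N \<and> es ! k = es ! j) = j"
      using that es(2) by (intro the_equality) (auto simp: N_def nth_eq_iff_index_eq)
    then show ?thesis by (simp add: w_def)
  qed
  have bij: "bij_betw (\<lambda>k. es ! k) {..<N} (rank_set S leq n)"
    using es by (intro bij_betw_nth) (auto simp: N_def)
  have "(\<Sum>y\<in>rank_set S leq n. cov_ind S leq y x * w y) = 0" if x: "x \<in> rank_set S leq (Suc n)" for x
  proof -
    obtain i where i: "i < length fs" "fs ! i = x" using x fs by (metis in_set_conv_nth)
    have "(\<Sum>y\<in>rank_set S leq n. cov_ind S leq y x * w y) = (\<Sum>j<N. cov_ind S leq (es ! j) x * w (es ! j))"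
      by (rule sum.reindex_bij_betw[OF bij, symmetric])
    also have "\<dots> = (\<Sum>j<N. cov_ind S leq (es ! j) x * v $ j)"
      by (rule sum.cong) (auto simp: w)
    also have "\<dots> = (M *\<^sub>v v) $ i"
      using i len v(1) by (simp add: M_def c_def scalar_prod_def lessThan_atLeast0)
    also have "\<dots> = 0" using v(3) i len by simp
    finally show ?thesis .
  qed
  from up_injective[OF this] have "w (es ! j) = 0" if "j < N" for j
    using that es(1) nth_mem[of j es] by (simp add: N_def)
  then have "v = 0\<^sub>v N" using v(1) w by (intro eq_vecI) auto
  with v(2) show False ..
qed

text \<open>The covers of an element lie in one rank, so the preimages chosen rank by rank glue to
  one function; on rank \<open>Suc n\<close> it is the preimage for rank \<open>n\<close>, hence
  \<open>rk x - 1\<close>.\<close>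

lemma down_surj_global:
  assumes "down_maps_surjective S leq"
  shows "\<exists>f :: 'a \<Rightarrow> int. \<forall>y\<in>S. (\<Sum>x\<in>{z \<in> S. covby S leq y z}. f x) = g y"
proof -
  have "\<forall>n. \<exists>f :: 'a \<Rightarrow> int. \<forall>y\<in>rank_set S leq n.
      (\<Sum>x\<in>rank_set S leq (Suc n). if covby S leq y x then f x else 0) = g y"
  proof
    fix n
    show "\<exists>f :: 'a \<Rightarrow> int. \<forall>y\<in>rank_set S leq n.
      (\<Sum>x\<in>rank_set S leq (Suc n). if covby S leq y x then f x else 0) = g y"
      using assms[unfolded down_maps_surjective_def, rule_format, of "Suc n" g] by simp
  qed
  from choice[OF this] obtain F :: "nat \<Rightarrow> 'a \<Rightarrow> int" where
    F: "\<And>n y. y \<in> rank_set S leq n \<Longrightarrow>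
      (\<Sum>x\<in>rank_set S leq (Suc n). if covby S leq y x then F n x else 0) = g y" by blast
  have "(\<Sum>x\<in>{z \<in> S. covby S leq y z}. F (rk x - 1) x) = g y" if y: "y \<in> S" for y
  proof -
    have "(\<Sum>x\<in>{z \<in> S. covby S leq y z}. F (rk x - 1) x)
        = (\<Sum>x\<in>rank_set S leq (Suc (rk y)). if covby S leq y x then F (rk y) x else 0)"
      using finite_rank_set
      by (intro sum.mono_neutral_cong_left) (auto simp: rank_set_def rank_covby)
    also have "\<dots> = g y" using y by (intro F) (simp add: rank_set_def)
    finally show ?thesis .
  qed
  then show ?thesis by (intro exI[of _ "\<lambda>x. F (rk x - 1) x"]) simp
qed

end

section \<open>Products of differential posets\<close>

lemma covby_mem: "covby S leq x y \<Longrightarrow> x \<in> S \<and> y \<in> S"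
  by (simp add: covby_def)

lemma covby_irrefl: "\<not> covby S leq x x"
  by (simp add: covby_def)

text \<open>A step that changed both coordinates would leave room for \<open>(x', y)\<close> in
  between.\<close>

lemma covby_prod_iff:
  assumes P: "partial_order_on' S le1" and Q: "partial_order_on' T le2"
  shows "covby (S \<times> T) (prod_le le1 le2) (x, y) (x', y') \<longleftrightarrow>
    covby S le1 x x' \<and> y = y' \<and> y \<in> T \<or> x = x' \<and> x \<in> S \<and> covby T le2 y y'"
    (is "?L \<longleftrightarrow> ?R")
proof
  have refl: "\<And>a. a \<in> S \<Longrightarrow> le1 a a" "\<And>a. a \<in> T \<Longrightarrow> le2 a a"
    using P Q unfolding partial_order_on'_def by auto
  {
    assume L: ?L
    then have mem: "x \<in> S" "x' \<in> S" "y \<in> T" "y' \<in> T" and le: "le1 x x'" "le2 y y'" and ne: "(x, y) \<noteq> (x', y')"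
      and btw: "\<And>a b. a \<in> S \<Longrightarrow> b \<in> T \<Longrightarrow> le1 x a \<Longrightarrow> le2 y b \<Longrightarrow> le1 a x' \<Longrightarrow> le2 b y' \<Longrightarrow>
        (a, b) = (x, y) \<or> (a, b) = (x', y')"
      unfolding covby_def prod_le_def by auto
    have "(x', y) = (x, y) \<or> (x', y) = (x', y')"
      using mem le refl by (intro btw) auto
    then consider "x = x'" | "y = y'" by auto
    then show ?R
    proof cases
      case 1
      have "b = y \<or> b = y'" if "b \<in> T" "le2 y b" "le2 b y'" for b
        using btw[of x b] that mem le refl 1 by auto
      then have "covby T le2 y y'" using mem le ne 1 unfolding covby_def by auto
      then show ?thesis using 1 mem by simp
    next
      case 2
      have "a = x \<or> a = x'" if "a \<in> S" "le1 x a" "le1 a x'" for a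
        using btw[of a y] that mem le refl 2 by auto
      then have "covby S le1 x x'" using mem le ne 2 unfolding covby_def by auto
      then show ?thesis using 2 mem by simp
    qed
  }
  have anti1: "a = b" if "a \<in> S" "b \<in> S" "le1 a b" "le1 b a" for a b
    using P that unfolding partial_order_on'_def by blast
  have anti2: "a = b" if "a \<in> T" "b \<in> T" "le2 a b" "le2 b a" for a b
    using Q that unfolding partial_order_on'_def by blast
  assume ?R
  then consider (1) "covby S le1 x x'" "y = y'" "y \<in> T" | (2) "x = x'" "x \<in> S" "covby T le2 y y'"
    by blast
  then show ?L
  proof cases
    case 1
    have "z = (x, y) \<or> z = (x', y')"
      if z: "z \<in> S \<times> T" "prod_le le1 le2 (x, y) z" "prod_le le1 le2 z (x', y')" for z
    proof -
      have "snd z = y" using z 1 by (intro anti2) (auto simp: prod_le_def)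
      moreover have "fst z = x \<or> fst z = x'" using z 1 by (auto simp: prod_le_def covby_def)
      ultimately show ?thesis using 1 by (cases z) auto
    qed
    then show ?thesis using 1 refl unfolding covby_def by (auto simp: prod_le_def)
  next
    case 2
    have "z = (x, y) \<or> z = (x', y')"
      if z: "z \<in> S \<times> T" "prod_le le1 le2 (x, y) z" "prod_le le1 le2 z (x', y')" for z
    proof -
      have "fst z = x" using z 2 by (intro anti1) (auto simp: prod_le_def)
      moreover have "snd z = y \<or> snd z = y'" using z 2 by (auto simp: prod_le_def covby_def)
      ultimately show ?thesis using 2 by (cases z) auto
    qed
    then show ?thesis using 2 refl unfolding covby_def by (auto simp: prod_le_def)
  qed
qed

lemma partial_order_prod:
  assumes P: "partial_order_on' S le1" and Q: "partial_order_on' T le2"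
  shows "partial_order_on' (S \<times> T) (prod_le le1 le2)"
  unfolding partial_order_on'_def
proof (intro conjI ballI impI)
  fix u v w assume uv: "u \<in> S \<times> T" "v \<in> S \<times> T"
  then have mem: "fst u \<in> S" "fst v \<in> S" "snd u \<in> T" "snd v \<in> T" by auto
  show "prod_le le1 le2 u u"
    using P Q mem unfolding partial_order_on'_def prod_le_def by blast
  show "u = v" if "prod_le le1 le2 u v \<and> prod_le le1 le2 v u"
  proof (rule prod_eqI)
    show "fst u = fst v" using P mem that unfolding partial_order_on'_def prod_le_def by blast
    show "snd u = snd v" using Q mem that unfolding partial_order_on'_def prod_le_def by blast
  qed
  assume "w \<in> S \<times> T" and le: "prod_le le1 le2 u v \<and> prod_le le1 le2 v w"
  then have w: "fst w \<in> S" "snd w \<in> T" by auto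
  have "le1 (fst u) (fst w)" using P mem w le unfolding partial_order_on'_def prod_le_def by blast
  moreover have "le2 (snd u) (snd w)" using Q mem w le unfolding partial_order_on'_def prod_le_def by blast
  ultimately show "prod_le le1 le2 u w" by (simp add: prod_le_def)
qed

lemma pointed_poset_prod:
  assumes P: "pointed_poset S le1 m" and Q: "pointed_poset T le2 m'"
  shows "pointed_poset (S \<times> T) (prod_le le1 le2) (m, m')"
proof -
  have "partial_order_on' (S \<times> T) (prod_le le1 le2)"
    using P Q by (intro partial_order_prod) (auto simp: pointed_poset_def)
  moreover have "locally_finite (S \<times> T) (prod_le le1 le2)"
    unfolding locally_finite_def
  proof (intro ballI)
    fix u v assume "u \<in> S \<times> T" "v \<in> S \<times> T"
    then have "finite ({z \<in> S. le1 (fst u) z \<and> le1 z (fst v)} \<times> {z \<in> T. le2 (snd u) z \<and> le2 z (snd v)})"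
      using P Q unfolding pointed_poset_def locally_finite_def by auto
    then show "finite {z \<in> S \<times> T. prod_le le1 le2 u z \<and> prod_le le1 le2 z v}"
      by (rule rev_finite_subset) (auto simp: prod_le_def)
  qed
  ultimately show ?thesis
    using P Q unfolding pointed_poset_def by (auto simp: prod_le_def)
qed

lemma is_rank_fun_prod:
  assumes P: "partial_order_on' S le1" "is_rank_fun S le1 rk1"
    and Q: "partial_order_on' T le2" "is_rank_fun T le2 rk2"
  shows "is_rank_fun (S \<times> T) (prod_le le1 le2) (\<lambda>(x, y). rk1 x + rk2 y)"
  unfolding is_rank_fun_def
proof (intro conjI ballI allI impI)
  fix u assume u: "u \<in> S \<times> T" and min: "\<forall>v\<in>S \<times> T. prod_le le1 le2 v u \<longrightarrow> v = u"
  obtain x y where xy: "u = (x, y)" "x \<in> S" "y \<in> T" using u by auto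
  have refl: "le1 x x" "le2 y y"
    using P Q xy unfolding partial_order_on'_def by auto
  have "a = x" if "a \<in> S" "le1 a x" for a
    using min[rule_format, of "(a, y)"] that xy refl by (simp add: prod_le_def)
  then have "rk1 x = 0" using P xy unfolding is_rank_fun_def by blast
  have "b = y" if "b \<in> T" "le2 b y" for b
    using min[rule_format, of "(x, b)"] that xy refl by (simp add: prod_le_def)
  then have "rk2 y = 0" using Q xy unfolding is_rank_fun_def by blast
  with \<open>rk1 x = 0\<close> show "(case u of (x, y) \<Rightarrow> rk1 x + rk2 y) = 0" by (simp add: xy)
next
  fix u v assume "covby (S \<times> T) (prod_le le1 le2) u v"
  then show "(case v of (x, y) \<Rightarrow> rk1 x + rk2 y) = (case u of (x, y) \<Rightarrow> rk1 x + rk2 y) + 1"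
    using covby_prod_iff[OF P(1) Q(1)] rank_fun_covby[OF P(2)] rank_fun_covby[OF Q(2)]
    by (cases u; cases v) auto
qed

text \<open>The product of two Leibniz-type expressions; the mixed terms pick out single points. For
  covers in a product these mixed terms are the same upwards and downwards.\<close>

lemma sum_product_rule:
  fixes p p' :: "'a \<Rightarrow> int" and q q' :: "'b \<Rightarrow> int"
  assumes fin: "finite A" "finite B" and mem: "x \<in> A" "x' \<in> A" "y \<in> B" "y' \<in> B"
  shows "(\<Sum>(a, b)\<in>A \<times> B. (p a * of_bool (b = y) + of_bool (a = x) * q b)
        * (p' a * of_bool (b = y') + of_bool (a = x') * q' b))
    = of_bool (y = y') * (\<Sum>a\<in>A. p a * p' a) + p x' * q' y + p' x * q y'
      + of_bool (x = x') * (\<Sum>b\<in>B. q b * q' b)"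
proof -
  have "(\<Sum>(a, b)\<in>A \<times> B. (p a * of_bool (b = y) + of_bool (a = x) * q b)
        * (p' a * of_bool (b = y') + of_bool (a = x') * q' b))
     = (\<Sum>a\<in>A. \<Sum>b\<in>B. (if b = y then of_bool (y = y') * (p a * p' a) else 0)
        + (if b = y then (if a = x' then p x' * q' y else 0) else 0)
        + (if b = y' then (if a = x then p' x * q y' else 0) else 0)
        + (if a = x then of_bool (x = x') * (q b * q' b) else 0))"
    unfolding sum.cartesian_product[symmetric]
    by (intro sum.cong refl, rename_tac a b, case_tac "a = x"; case_tac "a = x'"; case_tac "b = y"; case_tac "b = y'")
      (simp_all add: algebra_simps)
  also have "\<dots> = (\<Sum>a\<in>A. of_bool (y = y') * (p a * p' a) + (if a = x' then p x' * q' y else 0)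
        + (if a = x then p' x * q y' else 0)
        + (if a = x then \<Sum>b\<in>B. of_bool (x = x') * (q b * q' b) else 0))"
    using fin mem by (intro sum.cong refl) (simp add: sum.distrib)
  also have "\<dots> = of_bool (y = y') * (\<Sum>a\<in>A. p a * p' a) + p x' * q' y + p' x * q y'
      + of_bool (x = x') * (\<Sum>b\<in>B. q b * q' b)"
    using fin mem by (simp add: sum.distrib sum_distrib_left)
  finally show ?thesis .
qed

text \<open>The down map of the product is the sum of those of the factors. At first coordinates of
  rank \<open>i\<close> the second summand involves only values of that rank, so surjectivity of the
  first yields values of rank \<open>Suc i\<close>.\<close>

lemma ex_preimage_prod:
  fixes g :: "'a \<Rightarrow> 'b \<Rightarrow> int"
  assumes surj: "\<And>g :: 'a \<Rightarrow> int. \<exists>f. \<forall>x\<in>S. (\<Sum>z\<in>upS x. f z) = g x"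
    and rk: "\<And>x z. z \<in> upS x \<Longrightarrow> rk z = Suc (rk x)"
  shows "\<exists>f. \<forall>x\<in>S. \<forall>y\<in>T. (\<Sum>z\<in>upS x. f z y) + (\<Sum>w\<in>upT y. f x w) = g x y"
proof -
  from surj have "\<forall>g :: 'a \<Rightarrow> int. \<exists>f. \<forall>x\<in>S. (\<Sum>z\<in>upS x. f z) = g x" by blast
  from choice[OF this] obtain \<sigma> :: "('a \<Rightarrow> int) \<Rightarrow> 'a \<Rightarrow> int" where
    \<sigma>: "\<And>g x. x \<in> S \<Longrightarrow> (\<Sum>z\<in>upS x. \<sigma> g z) = g x" by blast
  \<comment> \<open>\<open>F i\<close> holds the values where the first coordinate has rank
    \<open>i\<close>; those of rank 0 may be chosen freely.\<close>
  define F where "F = rec_nat (\<lambda>x y. 0) (\<lambda>i G x y. \<sigma> (\<lambda>x'. g x' y - (\<Sum>w\<in>upT y. G x' w)) x)"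
  have F_Suc: "F (Suc i) x y = \<sigma> (\<lambda>x'. g x' y - (\<Sum>w\<in>upT y. F i x' w)) x" for i x y
    by (simp add: F_def)
  have "(\<Sum>z\<in>upS x. F (rk z) z y) + (\<Sum>w\<in>upT y. F (rk x) x w) = g x y" if x: "x \<in> S" for x y
  proof -
    have "(\<Sum>z\<in>upS x. F (rk z) z y) = (\<Sum>z\<in>upS x. \<sigma> (\<lambda>x'. g x' y - (\<Sum>w\<in>upT y. F (rk x) x' w)) z)"
      by (rule sum.cong) (auto simp: rk F_Suc)
    also have "\<dots> = g x y - (\<Sum>w\<in>upT y. F (rk x) x w)"
      by (rule \<sigma>[OF x])
    finally show ?thesis by simp
  qed
  then show ?thesis by (intro exI[of _ "\<lambda>x y. F (rk x) x y"]) simp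
qed

text \<open>The differences fall on \<open>q\<close>; the last two terms are what remains when
  \<open>q\<close> is continued by 0 to negative arguments.\<close>

lemma convolution_second_difference:
  fixes p q :: "nat \<Rightarrow> int"
  defines "c \<equiv> \<lambda>n. \<Sum>i\<le>n. p i * q (n - i)"
  shows "c (Suc (Suc n)) - 2 * c (Suc n) + c n
    = (\<Sum>i\<le>n. p i * (q (Suc (Suc n) - i) - 2 * q (Suc n - i) + q (n - i)))
      + p (Suc n) * (q 1 - 2 * q 0) + p (Suc (Suc n)) * q 0"
proof -
  have "c (Suc (Suc n)) = (\<Sum>i\<le>n. p i * q (Suc (Suc n) - i)) + p (Suc n) * q 1 + p (Suc (Suc n)) * q 0"
    by (simp add: c_def)
  moreover have "c (Suc n) = (\<Sum>i\<le>n. p i * q (Suc n - i)) + p (Suc n) * q 0"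
    by (simp add: c_def)
  ultimately show ?thesis
    by (simp add: c_def sum.distrib sum_subtractf sum_distrib_left algebra_simps)
qed

section \<open>The product as an instance of \<open>up_down\<close>\<close>

locale differential_product =
  P: differential_poset S le1 r + Q: differential_poset T le2 s
  for S :: "'a set" and le1 r and T :: "'b set" and le2 s +
  assumes growth: "\<And>n. int (rank_size T le2 (Suc (Suc n))) - int (rank_size T le2 (Suc n))
      \<ge> int (rank_size T le2 (Suc n)) - int (rank_size T le2 n)"
    and surj: "down_maps_surjective S le1 \<or> down_maps_surjective T le2"
begin

abbreviation "ple \<equiv> prod_le le1 le2"

abbreviation "X \<equiv> rank_set (S \<times> T) ple"

abbreviation "cv \<equiv> cov_ind (S \<times> T) ple"

lemma po: "partial_order_on' S le1" "partial_order_on' T le2"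
  using P.pointed Q.pointed by (auto simp: pointed_poset_def)

lemmas cov_iff = covby_prod_iff[OF po]

lemma rank_fun_prod: "is_rank_fun (S \<times> T) ple (rank_of (S \<times> T) ple)"
  unfolding rank_of_def
  using is_rank_fun_prod[OF po(1) P.rank_fun po(2) Q.rank_fun] someI_ex[of "is_rank_fun (S \<times> T) ple"] by blast

lemmas cov_rank = rank_fun_covby[OF rank_fun_prod]

lemma rank_prod:
  assumes "x \<in> S" "y \<in> T"
  shows "rank_of (S \<times> T) ple (x, y) = P.rk x + Q.rk y"
proof -
  from rank_fun_unique[OF pointed_poset_prod[OF P.pointed Q.pointed] rank_fun_prod
      is_rank_fun_prod[OF po(1) P.rank_fun po(2) Q.rank_fun], of "(x, y)"]
  show ?thesis using assms by simp
qed

lemma X_eq: "X n = (\<Union>i\<le>n. rank_set S le1 i \<times> rank_set T le2 (n - i))"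
  by (force simp: rank_set_def rank_prod)

lemma finite_X: "finite (X n)"
  unfolding X_eq using P.finite_rank_set Q.finite_rank_set by auto

lemma card_X: "card (X n) = (\<Sum>i\<le>n. rank_size S le1 i * rank_size T le2 (n - i))"
  unfolding X_eq rank_size_def card_cartesian_product[symmetric]
proof (rule card_UN_disjoint)
  show "\<forall>i\<in>{..n}. finite (rank_set S le1 i \<times> rank_set T le2 (n - i))"
    using P.finite_rank_set Q.finite_rank_set by blast
qed (auto simp: rank_set_def)

text \<open>By irreflexivity at most one term is nonzero, so the disjunction of covers becomes a sum
  to which \<open>sum_product_rule\<close> applies.\<close>

lemma cv_up:
  assumes "x \<in> S" "y \<in> T"
  shows "cv (x, y) (a, b) = cov_ind S le1 x a * of_bool (b = y) + of_bool (a = x) * cov_ind T le2 y b"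
  using assms by (auto simp: cov_ind_def cov_iff covby_irrefl)

lemma cv_down:
  assumes "x \<in> S" "y \<in> T"
  shows "cv (a, b) (x, y) = cov_ind S le1 a x * of_bool (b = y) + of_bool (a = x) * cov_ind T le2 b y"
  using assms by (auto simp: cov_ind_def cov_iff covby_irrefl)

text \<open>The mixed terms cancel in \<open>DU - UD\<close>, leaving \<open>r\<close> from the
  first factor and \<open>s\<close> from the second.\<close>

lemma card_common_covers_prod:
  assumes "u \<in> S \<times> T" "v \<in> S \<times> T"
  shows "int (card {z \<in> S \<times> T. covby (S \<times> T) ple u z \<and> covby (S \<times> T) ple v z})
    = int (card {z \<in> S \<times> T. covby (S \<times> T) ple z u \<and> covby (S \<times> T) ple z v})
      + (if u = v then int (r + s) else 0)"
proof -
  obtain x y where u: "u = (x, y)" "x \<in> S" "y \<in> T" using assms by auto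
  obtain x' y' where v: "v = (x', y')" "x' \<in> S" "y' \<in> T" using assms by auto
  \<comment> \<open>Finite sets with all neighbours of \<open>x\<close> and \<open>y\<close>; they
    also contain \<open>x'\<close> and \<open>y'\<close>, where the product rule evaluates.\<close>
  define A where "A = {x, x'} \<union> {z \<in> S. covby S le1 x z} \<union> {z \<in> S. covby S le1 z x}"
  define B where "B = {y, y'} \<union> {z \<in> T. covby T le2 y z} \<union> {z \<in> T. covby T le2 z y}"
  have fin: "finite A" "finite B"
    unfolding A_def B_def using P.finite_up P.finite_down Q.finite_up Q.finite_down by auto
  have mem: "x \<in> A" "x' \<in> A" "y \<in> B" "y' \<in> B" by (auto simp: A_def B_def)
  have cov_A: "a \<in> A" if "covby S le1 x a \<or> covby S le1 a x" for a
    using that by (auto simp: A_def dest: covby_mem)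
  have cov_B: "b \<in> B" if "covby T le2 y b \<or> covby T le2 b y" for b
    using that by (auto simp: B_def dest: covby_mem)
  have sub_up: "{z \<in> S \<times> T. covby (S \<times> T) ple u z} \<subseteq> A \<times> B"
  proof clarify
    fix a b assume "covby (S \<times> T) ple u (a, b)"
    then show "a \<in> A \<and> b \<in> B" using cov_A[of a] cov_B[of b] mem unfolding u(1) cov_iff by blast
  qed
  have sub_down: "{z \<in> S \<times> T. covby (S \<times> T) ple z u} \<subseteq> A \<times> B"
  proof clarify
    fix a b assume "covby (S \<times> T) ple (a, b) u"
    then show "a \<in> A \<and> b \<in> B" using cov_A[of a] cov_B[of b] mem unfolding u(1) cov_iff by blast
  qed
  have up1: "int (card {z \<in> S \<times> T. covby (S \<times> T) ple u z \<and> covby (S \<times> T) ple v z}) = (\<Sum>z\<in>A \<times> B. cv u z * cv v z)"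
    using fin by (intro sum_cov_ind_up[symmetric] order_trans[OF _ sub_up]) auto
  have up2: "(\<Sum>z\<in>A \<times> B. cv u z * cv v z)
      = (\<Sum>(a, b)\<in>A \<times> B. (cov_ind S le1 x a * of_bool (b = y) + of_bool (a = x) * cov_ind T le2 y b)
        * (cov_ind S le1 x' a * of_bool (b = y') + of_bool (a = x') * cov_ind T le2 y' b))"
    using u v by (intro sum.cong) (auto simp: cv_up)
  have up: "int (card {z \<in> S \<times> T. covby (S \<times> T) ple u z \<and> covby (S \<times> T) ple v z})
      = of_bool (y = y') * (\<Sum>a\<in>A. cov_ind S le1 x a * cov_ind S le1 x' a) + cov_ind S le1 x x' * cov_ind T le2 y' y + cov_ind S le1 x' x * cov_ind T le2 y y'
        + of_bool (x = x') * (\<Sum>b\<in>B. cov_ind T le2 y b * cov_ind T le2 y' b)"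
    unfolding up1 up2 by (rule sum_product_rule[OF fin mem])
  have down1: "int (card {z \<in> S \<times> T. covby (S \<times> T) ple z u \<and> covby (S \<times> T) ple z v}) = (\<Sum>z\<in>A \<times> B. cv z u * cv z v)"
    using fin by (intro sum_cov_ind_down[symmetric] order_trans[OF _ sub_down]) auto
  have down2: "(\<Sum>z\<in>A \<times> B. cv z u * cv z v)
      = (\<Sum>(a, b)\<in>A \<times> B. (cov_ind S le1 a x * of_bool (b = y) + of_bool (a = x) * cov_ind T le2 b y)
        * (cov_ind S le1 a x' * of_bool (b = y') + of_bool (a = x') * cov_ind T le2 b y'))"
    using u v by (intro sum.cong) (auto simp: cv_down)
  have down: "int (card {z \<in> S \<times> T. covby (S \<times> T) ple z u \<and> covby (S \<times> T) ple z v})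
      = of_bool (y = y') * (\<Sum>a\<in>A. cov_ind S le1 a x * cov_ind S le1 a x') + cov_ind S le1 x' x * cov_ind T le2 y y' + cov_ind S le1 x x' * cov_ind T le2 y' y
        + of_bool (x = x') * (\<Sum>b\<in>B. cov_ind T le2 b y * cov_ind T le2 b y')"
    unfolding down1 down2 by (rule sum_product_rule[OF fin mem])
  have "(\<Sum>a\<in>A. cov_ind S le1 x a * cov_ind S le1 x' a)
      = (\<Sum>a\<in>A. cov_ind S le1 a x * cov_ind S le1 a x') + (if x = x' then int r else 0)"
    using u v fin by (intro P.sum_cov_ind) (auto simp: A_def)
  moreover have "(\<Sum>b\<in>B. cov_ind T le2 y b * cov_ind T le2 y' b)
      = (\<Sum>b\<in>B. cov_ind T le2 b y * cov_ind T le2 b y') + (if y = y' then int s else 0)"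
    using u v fin by (intro Q.sum_cov_ind) (auto simp: B_def)
  ultimately show ?thesis
    unfolding up down by (auto simp: u v)
qed

lemma sum_c_up:
  assumes "u \<in> X n"
  shows "(\<Sum>z\<in>X (Suc n). cv u z * cv v z) = int (card {z \<in> S \<times> T. covby (S \<times> T) ple u z \<and> covby (S \<times> T) ple v z})"
  using assms finite_X by (intro sum_cov_ind_up) (auto simp: rank_set_def cov_rank)

lemma ex_preimage:
  "\<exists>f. \<forall>u\<in>X n. (\<Sum>z\<in>X (Suc n). cv u z * f z) = (g u :: int)"
proof -
  let ?U1 = "\<lambda>x. {z \<in> S. covby S le1 x z}" and ?U2 = "\<lambda>y. {z \<in> T. covby T le2 y z}"
  have "\<exists>f. \<forall>x\<in>S. \<forall>y\<in>T. (\<Sum>z\<in>?U1 x. f z y) + (\<Sum>w\<in>?U2 y. f x w) = g (x, y)"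
    using surj
  proof
    assume "down_maps_surjective S le1"
    from ex_preimage_prod[OF P.down_surj_global[OF this], of P.rk T ?U2 "\<lambda>x y. g (x, y)"]
    show ?thesis by (simp add: P.rank_covby)
  next
    \<comment> \<open>The same recursion with the factors exchanged.\<close>
    assume "down_maps_surjective T le2"
    from ex_preimage_prod[OF Q.down_surj_global[OF this], of Q.rk S ?U1 "\<lambda>y x. g (x, y)"]
    obtain f where "\<forall>y\<in>T. \<forall>x\<in>S. (\<Sum>z\<in>?U2 y. f z x) + (\<Sum>w\<in>?U1 x. f y w) = g (x, y)"
      by (auto simp: Q.rank_covby)
    then show ?thesis by (intro exI[of _ "\<lambda>x y. f y x"]) (simp add: add.commute)
  qed
  then obtain f where f: "\<And>x y. x \<in> S \<Longrightarrow> y \<in> T \<Longrightarrow> (\<Sum>z\<in>?U1 x. f z y) + (\<Sum>w\<in>?U2 y. f x w) = g (x, y)"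
    by blast
  have "(\<Sum>z\<in>X (Suc n). cv u z * (case z of (a, b) \<Rightarrow> f a b)) = g u" if u: "u \<in> X n" for u
  proof -
    obtain x y where xy: "u = (x, y)" "x \<in> S" "y \<in> T" using u by (auto simp: rank_set_def)
    let ?A = "(\<lambda>a. (a, y)) ` ?U1 x" and ?B = "(\<lambda>b. (x, b)) ` ?U2 y"
    have "(\<Sum>z\<in>X (Suc n). cv u z * (case z of (a, b) \<Rightarrow> f a b)) = (\<Sum>z\<in>?A \<union> ?B. case z of (a, b) \<Rightarrow> f a b)"
    proof (rule sum.mono_neutral_cong_right)
      show "?A \<union> ?B \<subseteq> X (Suc n)"
        using u xy by (auto simp: rank_set_def rank_prod P.rank_covby Q.rank_covby)
    qed (use finite_X xy in \<open>auto simp: cov_ind_def cov_iff rank_set_def image_iff\<close>)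
    also have "\<dots> = (\<Sum>z\<in>?A. case z of (a, b) \<Rightarrow> f a b) + (\<Sum>z\<in>?B. case z of (a, b) \<Rightarrow> f a b)"
      using P.finite_up Q.finite_up by (intro sum.union_disjoint) (auto simp: covby_irrefl)
    also have "\<dots> = (\<Sum>z\<in>?U1 x. f z y) + (\<Sum>w\<in>?U2 y. f x w)"
      by (simp add: sum.reindex inj_on_def)
    also have "\<dots> = g u" using f xy by simp
    finally show ?thesis .
  qed
  then show ?thesis by (intro exI[of _ "\<lambda>(a, b). f a b"]) simp
qed

text \<open>The rank sizes are a convolution, and only the term with \<open>s - 2\<close> can be
  negative, for \<open>s = 1\<close>. Then the second difference of \<open>T\<close> at its bottom
  is 1 and contributes the size of rank \<open>n\<close> of \<open>S\<close>, while
  \<open>rank_size_mono\<close> controls the rest.\<close>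

lemma card_X_second_difference:
  "int (card (X (Suc (Suc n)))) - 2 * int (card (X (Suc n))) + int (card (X n)) > 0"
proof -
  let ?p = "\<lambda>i. int (rank_size S le1 i)" and ?q = "\<lambda>i. int (rank_size T le2 i)"
  have card: "int (card (X k)) = (\<Sum>i\<le>k. ?p i * ?q (k - i))" for k
    by (simp add: card_X)
  define \<Delta> where "\<Delta> = (\<lambda>i. ?q (Suc (Suc n) - i) - 2 * ?q (Suc n - i) + ?q (n - i))"
  have \<Delta>: "\<Delta> i \<ge> 0" if "i \<le> n" for i
    using growth[of "n - i"] that by (simp add: \<Delta>_def Suc_diff_le)
  have eq: "int (card (X (Suc (Suc n)))) - 2 * int (card (X (Suc n))) + int (card (X n))
      = (\<Sum>i\<le>n. ?p i * \<Delta> i) + ?p (Suc n) * (int s - 2) + ?p (Suc (Suc n))"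
    unfolding card \<Delta>_def using convolution_second_difference[of ?p ?q n] Q.rank_size_0 Q.rank_size_1 by simp
  have pos: "?p k > 0" for k using P.rank_size_pos by simp
  have nonneg: "(\<Sum>i\<le>n. ?p i * \<Delta> i) \<ge> 0"
    using \<Delta> by (intro sum_nonneg) auto
  show ?thesis
  proof (cases "s = 1")
    case False
    then have "?p (Suc n) * (int s - 2) \<ge> 0" using Q.r_pos by simp
    then show ?thesis using eq nonneg pos[of "Suc (Suc n)"] by linarith
  next
    case True
    have "\<Delta> n = 1"
      using Q.rank_size_0 Q.rank_size_1 Q.rank_size_2[OF True] True by (simp add: \<Delta>_def numeral_2_eq_2)
    then have "?p n \<le> (\<Sum>i\<le>n. ?p i * \<Delta> i)"
      using member_le_sum[of n "{..n}" "\<lambda>i. ?p i * \<Delta> i"] \<Delta> by auto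
    moreover have "?p (Suc n) \<le> ?p (Suc (Suc n))" using P.rank_size_mono by simp
    ultimately show ?thesis using eq pos[of n] True by simp
  qed
qed

definition d :: "nat \<Rightarrow> nat" where
  "d n = (case n of 0 \<Rightarrow> 1 | Suc k \<Rightarrow> card (X (Suc k)) - card (X k))"

lemma card_X_0: "card (X 0) = 1"
  by (simp add: card_X P.rank_size_0 Q.rank_size_0)

lemma card_X_1: "card (X (Suc 0)) = r + s"
  using P.rank_size_1 Q.rank_size_1 by (simp add: card_X P.rank_size_0 Q.rank_size_0)

lemma card_X_less: "card (X n) < card (X (Suc n))"
proof (induction n)
  case 0
  show ?case using P.r_pos Q.r_pos by (simp add: card_X_0 card_X_1)
next
  case (Suc n)
  then show ?case using card_X_second_difference[of n] by linarith
qed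

sublocale ud: up_down X cv "r + s" d
proof
  show "finite (X n)" for n by (rule finite_X)
  show "(\<Sum>z\<in>X (Suc 0). cv u z * cv v z) = (if u = v then int (r + s) else 0)" if "u \<in> X 0" "v \<in> X 0" for u v
  proof -
    have "{z \<in> S \<times> T. covby (S \<times> T) ple z u \<and> covby (S \<times> T) ple z v} = {}"
      using that cov_rank by (auto simp: rank_set_def)
    then have "card {z \<in> S \<times> T. covby (S \<times> T) ple z u \<and> covby (S \<times> T) ple z v} = 0"
      by (simp only: card.empty)
    then show ?thesis
      using sum_c_up[OF that(1), of v] card_common_covers_prod[of u v] that by (simp add: rank_set_def)
  qed
  show "(\<Sum>z\<in>X (Suc (Suc n)). cv u z * cv v z) = (\<Sum>z\<in>X n. cv z u * cv z v) + (if u = v then int (r + s) else 0)"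
    if "u \<in> X (Suc n)" "v \<in> X (Suc n)" for u v n
  proof -
    have "(\<Sum>z\<in>X n. cv z u * cv z v) = int (card {z \<in> S \<times> T. covby (S \<times> T) ple z u \<and> covby (S \<times> T) ple z v})"
      using finite_X that cov_rank by (intro sum_cov_ind_down) (auto simp: rank_set_def)
    then show ?thesis
      using sum_c_up[OF that(1), of v] card_common_covers_prod[of u v] that by (simp add: rank_set_def)
  qed
  show "\<exists>f. \<forall>y\<in>X n. (\<Sum>x\<in>X (Suc n). cv y x * f x) = g y" for n g by (rule ex_preimage)
  show "card (X 0) = d 0" by (simp add: d_def card_X_0)
  show "card (X (Suc n)) = card (X n) + d (Suc n)" for n
    using card_X_less[of n] by (simp add: d_def)
  \<comment> \<open>\<open>d 0 = 1\<close> and \<open>d 1 = r + s - 1\<close>, so the first step is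
    strict unless \<open>r = s = 1\<close>; later steps are second differences.\<close>
  show "d n < d (Suc n) \<or> n = 0 \<and> r + s = 2 \<and> d n \<le> d (Suc n)" for n
  proof (cases n)
    case 0
    then show ?thesis using P.r_pos Q.r_pos by (auto simp: d_def card_X_0 card_X_1)
  next
    case (Suc k)
    then show ?thesis
      using card_X_second_difference[of k] card_X_less[of k] card_X_less[of "Suc k"] by (simp add: d_def)
  qed
qed

lemma smith_normal_form:
  assumes "distinct es" "set es = X n"
  shows "has_smith_normal_form (DU_plus_xI (S \<times> T) ple es)"
proof -
  have "DU_plus_xI (S \<times> T) ple es = mat (length es) (length es)
    (\<lambda>(i, j). of_int (\<Sum>z\<in>X (Suc n). cv (es ! i) z * cv (es ! j) z)
       + (if i = j then [:0, 1:] else 0 :: int poly))"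
    unfolding DU_plus_xI_def
  proof (rule cong_mat)
    fix i j assume "i < length es" "j < length es"
    then have "es ! i \<in> X n" using assms nth_mem by auto
    then have "(\<Sum>z\<in>X (Suc n). cv (es ! i) z * cv (es ! j) z)
        = int (card {z \<in> S \<times> T. covby (S \<times> T) ple (es ! j) z \<and> covby (S \<times> T) ple (es ! i) z})"
      by (simp add: sum_c_up conj_commute)
    then show "(case (i, j) of (i, j) \<Rightarrow>
          of_nat (card {z \<in> S \<times> T. covby (S \<times> T) ple (es ! j) z \<and> covby (S \<times> T) ple (es ! i) z})
          + (if i = j then [:0, 1:] else 0 :: int poly)) =
        (case (i, j) of (i, j) \<Rightarrow> of_int (\<Sum>z\<in>X (Suc n). cv (es ! i) z * cv (es ! j) z)
          + (if i = j then [:0, 1:] else 0))"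
      by (simp only: prod.case of_int_of_nat_eq)
  qed simp_all
  then show ?thesis using ud.has_smith_normal_form_DU_plus_xI[OF assms] by simp
qed

end

theorem mainTheorem7:
  fixes S :: "'a set" and le1 :: "'a \<Rightarrow> 'a \<Rightarrow> bool" and r :: nat
    and T :: "'b set" and le2 :: "'b \<Rightarrow> 'b \<Rightarrow> bool" and s :: nat
  assumes P_diff: "differential S le1 r"
    and Q_diff: "differential T le2 s"
    and Q_growth: "\<forall>n\<ge>2. int (rank_size T le2 n) - int (rank_size T le2 (n - 1))
                         \<ge> int (rank_size T le2 (n - 1)) - int (rank_size T le2 (n - 2))"
    and surj: "down_maps_surjective S le1 \<or> down_maps_surjective T le2"
  shows "\<forall>n (es :: ('a \<times> 'b) list). distinct es \<and> set es = rank_set (S \<times> T) (prod_le le1 le2) n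
           \<longrightarrow> has_smith_normal_form (DU_plus_xI (S \<times> T) (prod_le le1 le2) es)"
proof -
  interpret differential_product S le1 r T le2 s
  proof
    show "int (rank_size T le2 (Suc n)) - int (rank_size T le2 n)
        \<le> int (rank_size T le2 (Suc (Suc n))) - int (rank_size T le2 (Suc n))" for n
      using Q_growth[rule_format, of "Suc (Suc n)"] by simp
  qed (fact P_diff Q_diff surj)+
  show ?thesis using smith_normal_form by blast
qed

end
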